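(* Suppose an algorithm knows $n$ and has access to $\mathbf{RandVert}$, $\mathbf{RandNbr}$, $\mathbf{RandEdge}$ and $\mathbf{Degree}$, together with either $\mathbf{Pair}$ or $\mathbf{Additive}$. Then there is a randomized algorithm that, given $\varepsilon\in(0,1)$, returns a $(1\pm\varepsilon)$-approximation to $d$. With the $\mathbf{Pair}$ oracle it makes $\widetilde{O}((n/d)^{1/3})$ queries. With the $\mathbf{Additive}$ oracle it makes $\widetilde{O}((n/d)^{1/4})$ queries.
   Context: $G=(V,E)$ is an unknown simple undirected graph with $n=|V|$ vertices and $m=|E|$ edges, no isolated vertices, and average degree $d=2m/n$. The oracles are: - $\mathbf{RandVert}()$ returns a uniformly random vertex. - $\mathbf{RandNbr}(x)$ returns a uniformly random neighbor of $x$. - $\mathbf{Degree}(x)$ returns $\deg(x)$. - $\mathbf{Pair}(x,y)$ returns whether $\{x,y\}\in E$. - $\mathbf{Additive}(S)$, for $S\subseteq V$, returns the number of edges with both endpoints in $S$ and costs $|S|$. - $\mathbf{RandEdge}()$ returns a uniformly random edge. All oracles other than $\mathbf{Additive}$ have unit cost. A $(1\pm\varepsilon)$-approximation to $d$ is a value in $[(1-\varepsilon)d,(1+\varepsilon)d]$. The approximation guarantee holds with constant probability bounded away from $1/2$. $\widetilde{O}$ hides factors polynomial in $\log n$ and $1/\varepsilon$; the explicit bounds are $O(\varepsilon^{-2}\log^5 n\,(n/d)^{1/3})$ and $O(\varepsilon^{-2}\log^5 n\,(n/d)^{1/4})$ expected queries. *)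

theory Defs
  imports "HOL-Probability.Probability"
begin

section \<open>Simple graphs\<close>

text \<open>Edges are two-element sets of vertices, so there are no loops and no parallel edges.\<close>

definition simple_graph :: "'v set \<Rightarrow> 'v set set \<Rightarrow> bool" where
  "simple_graph V E \<longleftrightarrow> finite V \<and> (\<forall>e\<in>E. e \<subseteq> V \<and> card e = 2)"

definition neighbors :: "'v set set \<Rightarrow> 'v \<Rightarrow> 'v set" where
  "neighbors E x = {y. {x, y} \<in> E}"

definition no_isolated_vertices :: "'v set \<Rightarrow> 'v set set \<Rightarrow> bool" where
  "no_isolated_vertices V E \<longleftrightarrow> (\<forall>x\<in>V. neighbors E x \<noteq> {})"

definition average_degree :: "'v set \<Rightarrow> 'v set set \<Rightarrow> real" where
  "average_degree V E = 2 * real (card E) / real (card V)"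

text \<open>The graphs an algorithm may be run on. The graph must have a vertex, since otherwise
  the average degree is undefined; without isolated vertices it then has an edge as well.\<close>

definition input_graph :: "'v set \<Rightarrow> 'v set set \<Rightarrow> bool" where
  "input_graph V E \<longleftrightarrow> simple_graph V E \<and> V \<noteq> {} \<and> no_isolated_vertices V E"


section \<open>Oracles\<close>

text \<open>PairQuery is the oracle Pair; the longer name keeps the constructor of pairs unshadowed.\<close>

datatype 'v query =
    RandVert
  | RandNbr 'v
  | RandEdge
  | Degree 'v
  | PairQuery 'v 'v
  | Additive "'v set"

datatype 'v answer =
    Vertex 'v
  | Edge "'v set"
  | Number nat
  | Truth bool

fun cost :: "'v query \<Rightarrow> nat" where
  "cost (Additive S) = card S"
| "cost _ = 1"

text \<open>A query that mentions something outside the vertex set gets no answer: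
  its answer distribution is the null subdistribution. In particular the oracles cannot be used
  to test whether a name is the name of a vertex. Note that spmf_of_set is the null
  subdistribution on the empty set, which covers RandNbr outside of the vertex set.\<close>

fun respond :: "'v set \<Rightarrow> 'v set set \<Rightarrow> 'v query \<Rightarrow> 'v answer spmf" where
  "respond V E RandVert = map_spmf Vertex (spmf_of_set V)"
| "respond V E (RandNbr x) = map_spmf Vertex (spmf_of_set (neighbors E x))"
| "respond V E RandEdge = map_spmf Edge (spmf_of_set E)"
| "respond V E (Degree x) =
     (if x \<in> V then return_spmf (Number (card (neighbors E x))) else return_pmf None)"
| "respond V E (PairQuery x y) =
     (if x \<in> V \<and> y \<in> V then return_spmf (Truth ({x, y} \<in> E)) else return_pmf None)"
| "respond V E (Additive S) =
     (if S \<subseteq> V then return_spmf (Number (card {e \<in> E. e \<subseteq> S})) else return_pmf None)"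

definition base_queries :: "'v query set" where
  "base_queries = {RandVert, RandEdge} \<union> range RandNbr \<union> range Degree"

definition pair_queries :: "'v query set" where
  "pair_queries = base_queries \<union> {PairQuery x y | x y. True}"

definition additive_queries :: "'v query set" where
  "additive_queries = base_queries \<union> range Additive"


section \<open>Randomized algorithms\<close>

text \<open>A randomized algorithm is a strategy: it outputs a number, or makes a random choice of
  its own, or asks a query and continues depending on the answer. The type is coinductive since
  the number of queries need not be bounded. As usual for query complexity, local computation
  is free and not restricted to be computable.\<close>

codatatype 'v algorithm =
    Output real
  | Choose "'v algorithm pmf"
  | Ask "'v query" "'v answer \<Rightarrow> 'v algorithm"

text \<open>The joint distribution of the output and the total cost of the queries when the
  queries in Q are available on the graph with vertex set V and edge set E.
  The missing probability mass is the probability that the run yields no output: it does not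
  terminate, or it asks an unavailable query or one without an answer.\<close>

partial_function (spmf) run ::
  "'v query set \<Rightarrow> 'v set \<Rightarrow> 'v set set \<Rightarrow> 'v algorithm \<Rightarrow> (real \<times> nat) spmf" where
  "run Q V E alg = (case alg of
     Output r \<Rightarrow> return_spmf (r, 0)
   | Choose p \<Rightarrow> bind_spmf (spmf_of_pmf p) (\<lambda>alg'. run Q V E alg')
   | Ask q k \<Rightarrow>
       if q \<in> Q
       then bind_spmf (respond V E q) (\<lambda>a.
              bind_spmf (run Q V E (k a)) (\<lambda>rc. return_spmf (fst rc, cost q + snd rc)))
       else return_pmf None)"

definition expected_cost ::
  "'v query set \<Rightarrow> 'v set \<Rightarrow> 'v set set \<Rightarrow> 'v algorithm \<Rightarrow> ennreal" where
  "expected_cost Q V E alg =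
     (\<integral>\<^sup>+ rc. ennreal (real (snd rc)) \<partial>measure_spmf (run Q V E alg))"

definition prob_output ::
  "'v query set \<Rightarrow> 'v set \<Rightarrow> 'v set set \<Rightarrow> 'v algorithm \<Rightarrow> real set \<Rightarrow> real" where
  "prob_output Q V E alg R = measure (measure_spmf (run Q V E alg)) {rc. fst rc \<in> R}"

text \<open>The family A receives the number of vertices and the accuracy, but neither the vertex
  set nor the edge set. The requirement that every run is lossless, i.e. terminates almost surely
  and asks only available and answerable queries, also makes the expected cost meaningful:
  there is no missing mass that it could ignore.
  B bounds the expected cost in terms of the number of vertices, the average degree and the
  accuracy.\<close>

definition approximates_average_degree ::
  "'v query set \<Rightarrow> (nat \<Rightarrow> real \<Rightarrow> 'v algorithm) \<Rightarrow> real \<Rightarrow> (real \<Rightarrow> real \<Rightarrow> real \<Rightarrow> real) \<Rightarrow> bool"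
where
  "approximates_average_degree Q A p B \<longleftrightarrow>
     (\<forall>V E \<epsilon>. input_graph V E \<and> 0 < \<epsilon> \<and> \<epsilon> < 1 \<longrightarrow>
        (let alg = A (card V) \<epsilon>; d = average_degree V E in
           lossless_spmf (run Q V E alg)
         \<and> prob_output Q V E alg {(1 - \<epsilon>) * d .. (1 + \<epsilon>) * d} \<ge> p
         \<and> expected_cost Q V E alg \<le> ennreal (B (real (card V)) d \<epsilon>)))"

end

theory Submission
  imports Defs
begin

text \<open>
  Fix a guess \<open>g\<close> for the average degree \<open>d\<close> and call a vertex light if its degree is at most a
  threshold \<open>\<theta> \<ge> g\<close>. If a constant fraction of the edge endpoints is light, then \<open>d\<close> is the ratio
  of the mean of \<open>deg v \<cdot> 1[v light]\<close> over a uniform vertex and the probability that a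
  uniform edge endpoint is light; about \<open>\<theta> / g\<close> vertices suffice to estimate the former.
  Otherwise a constant fraction of the edges joins heavy vertices. For two independent random edge
  endpoints \<open>u\<close> and \<open>v\<close>, the mean of \<open>1[u, v heavy and adjacent] / (deg u deg v)\<close> is then of order
  \<open>1 / (n d)\<close>, and its product with \<open>n d\<close> is the fraction of edges that join heavy vertices. Up to
  constants, the second moment is at most \<open>1 / (\<theta>\<^sup>2 n d)\<close>, so \<open>n g / \<theta>\<^sup>2\<close> independent pairs suffice,
  which costs as many Pair queries; balancing this against \<open>\<theta> / g\<close> gives \<open>(n / g) powr (1 / 3)\<close>.
  With Additive, all pairs formed by two samples of size \<open>s\<close> are inspected at cost about \<open>s\<close>, so
  that \<open>s = sqrt (n g) / \<theta>\<close> suffices, which gives \<open>(n / g) powr (1 / 4)\<close>.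
  The guess is halved, starting from \<open>n\<close>, until it is confirmed by the estimate. For a guess that is
  already too small the confirmation fails with probability at most \<open>1 / 4\<close> while the cost at most
  doubles, so that late guesses do not spoil the expected cost.
\<close>


section \<open>Query programs in continuation-passing style\<close>

type_synonym ('v, 'a) program = "('a \<Rightarrow> 'v algorithm) \<Rightarrow> 'v algorithm"

text \<open>A program receives its continuation as an argument, since algorithms themselves can only
  output real numbers. The witness \<open>M\<close> is the joint distribution of result and cost.\<close>

definition implements ::
  "'v query set \<Rightarrow> 'v set \<Rightarrow> 'v set set \<Rightarrow> ('v, 'a) program \<Rightarrow> 'a pmf \<Rightarrow> nat \<Rightarrow> bool" where
  "implements Q V E P D c \<longleftrightarrow> (\<exists>M. map_pmf fst M = D \<and> (\<forall>x\<in>set_pmf M. snd x \<le> c) \<and>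
     (\<forall>k. run Q V E (P k) = bind_spmf (spmf_of_pmf M)
        (\<lambda>x. map_spmf (apsnd ((+) (snd x))) (run Q V E (k (fst x))))))"

definition pret :: "'a \<Rightarrow> ('v, 'a) program" where
  "pret a = (\<lambda>k. k a)"

definition pbind :: "('v, 'a) program \<Rightarrow> ('a \<Rightarrow> ('v, 'b) program) \<Rightarrow> ('v, 'b) program" where
  "pbind P f = (\<lambda>k. P (\<lambda>a. f a k))"

section \<open>Unfolding runs and composing programs\<close>

lemma run_Output [simp]: "run Q V E (Output r) = return_spmf (r, 0)"
  by (subst run.simps) simp

lemma run_Choose: "run Q V E (Choose p) = bind_spmf (spmf_of_pmf p) (run Q V E)"
  by (subst run.simps) simp

lemma run_Ask: "q \<in> Q \<Longrightarrow> run Q V E (Ask q k) =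
    bind_spmf (respond V E q) (\<lambda>a. map_spmf (apsnd ((+) (cost q))) (run Q V E (k a)))"
  by (subst run.simps) (simp add: map_spmf_conv_bind_spmf apsnd_def map_prod_def split_def)

lemma apsnd_plus_0 [simp]: "apsnd ((+) (0 :: nat)) = id"
  by auto

lemma implements_pret: "implements Q V E (pret a) (return_pmf a) 0"
  unfolding implements_def pret_def
  by (rule exI[of _ "return_pmf (a, 0)"]) simp

lemma implements_mono: "implements Q V E P D c \<Longrightarrow> c \<le> c' \<Longrightarrow> implements Q V E P D c'"
  unfolding implements_def
  by (elim exE conjE, rule exI, intro conjI, assumption) (auto intro: order_trans)

text \<open>\<open>Degree\<close>, \<open>PairQuery\<close> and \<open>Additive\<close> are answered
  only inside the vertex set, so \<open>f a\<close> can be expected to behave well only for results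
  in the support of \<open>D\<close>. The costs are worst-case bounds and add up.\<close>

lemma implements_pbind:
  assumes "implements Q V E P D c"
    and "\<And>a. a \<in> set_pmf D \<Longrightarrow> implements Q V E (f a) (D' a) c'"
  shows "implements Q V E (pbind P f) (bind_pmf D D') (c + c')"
proof -
  obtain M where M: "map_pmf fst M = D" "\<And>x. x\<in>set_pmf M \<Longrightarrow> snd x \<le> c"
    "\<And>k. run Q V E (P k) = bind_spmf (spmf_of_pmf M)
        (\<lambda>x. map_spmf (apsnd ((+) (snd x))) (run Q V E (k (fst x))))"
    using assms(1) unfolding implements_def by blast
  have "\<forall>a\<in>set_pmf D. \<exists>N. map_pmf fst N = D' a \<and> (\<forall>x\<in>set_pmf N. snd x \<le> c') \<and>
     (\<forall>k. run Q V E (f a k) = bind_spmf (spmf_of_pmf N)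
        (\<lambda>x. map_spmf (apsnd ((+) (snd x))) (run Q V E (k (fst x)))))"
    using assms(2) unfolding implements_def by blast
  from bchoice[OF this] obtain N where N': "\<forall>a\<in>set_pmf D. map_pmf fst (N a) = D' a \<and>
     (\<forall>x\<in>set_pmf (N a). snd x \<le> c') \<and>
     (\<forall>k. run Q V E (f a k) = bind_spmf (spmf_of_pmf (N a))
        (\<lambda>x. map_spmf (apsnd ((+) (snd x))) (run Q V E (k (fst x)))))" ..
  have N: "\<And>a. a \<in> set_pmf D \<Longrightarrow> map_pmf fst (N a) = D' a"
    "\<And>a x. a \<in> set_pmf D \<Longrightarrow> x\<in>set_pmf (N a) \<Longrightarrow> snd x \<le> c'"
    "\<And>a k. a \<in> set_pmf D \<Longrightarrow> run Q V E (f a k) = bind_spmf (spmf_of_pmf (N a))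
        (\<lambda>x. map_spmf (apsnd ((+) (snd x))) (run Q V E (k (fst x))))"
    by (simp_all only: bspec[OF N'])
  have inD: "fst x \<in> set_pmf D" if "x \<in> set_pmf M" for x
    using that M(1) by auto
  \<comment> \<open>The joint witness continues a run of \<open>M\<close> by a run of
    \<open>N\<close> and shifts the cost by that of the first stage.\<close>
  let ?M = "bind_pmf M (\<lambda>x. map_pmf (apsnd ((+) (snd x))) (N (fst x)))"
  have "map_pmf fst ?M = bind_pmf M (\<lambda>x. map_pmf fst (N (fst x)))"
    by (simp add: map_bind_pmf pmf.map_comp o_def)
  also have "\<dots> = bind_pmf M (\<lambda>x. D' (fst x))"
    by (intro bind_pmf_cong refl N(1) inD)
  also have "\<dots> = bind_pmf D D'"
    by (simp add: M(1)[symmetric] bind_map_pmf)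
  finally have 1: "map_pmf fst ?M = bind_pmf D D'" .
  have 2: "\<forall>x\<in>set_pmf ?M. snd x \<le> c + c'"
  proof
    fix z assume "z \<in> set_pmf ?M"
    then obtain x y where xy: "x \<in> set_pmf M" "y \<in> set_pmf (N (fst x))" "z = apsnd ((+) (snd x)) y"
      by auto
    then show "snd z \<le> c + c'"
      using M(2)[OF xy(1)] N(2)[OF inD[OF xy(1)] xy(2)] by simp
  qed
  have 3: "run Q V E (pbind P f k) = bind_spmf (spmf_of_pmf ?M)
        (\<lambda>x. map_spmf (apsnd ((+) (snd x))) (run Q V E (k (fst x))))" for k
  proof -
    have "run Q V E (pbind P f k) = bind_pmf M (\<lambda>x. map_spmf (apsnd ((+) (snd x)))
        (bind_spmf (spmf_of_pmf (N (fst x)))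
        (\<lambda>x. map_spmf (apsnd ((+) (snd x))) (run Q V E (k (fst x))))))"
      unfolding pbind_def M(3) bind_spmf_of_pmf
      by (intro bind_pmf_cong refl arg_cong2[of _ _ _ _ map_spmf] N(3)[unfolded bind_spmf_of_pmf] inD)
    also have "\<dots> = bind_spmf (spmf_of_pmf ?M)
        (\<lambda>x. map_spmf (apsnd ((+) (snd x))) (run Q V E (k (fst x))))"
      by (simp add: bind_spmf_of_pmf bind_assoc_pmf bind_map_pmf map_spmf_bind_spmf spmf.map_comp
          o_def apsnd_def map_prod_def split_def add.assoc map_bind_pmf)
    finally show ?thesis .
  qed
  show ?thesis
    unfolding implements_def using 1 2 3 by blast
qed

lemma implements_map:
  assumes "implements Q V E P D c"
  shows "implements Q V E (pbind P (\<lambda>a. pret (f a))) (map_pmf f D) c"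
  using implements_pbind[OF assms, of "\<lambda>a. pret (f a)" "\<lambda>a. return_pmf (f a)" 0]
  by (simp add: implements_pret map_pmf_def)

section \<open>Repetition, oracle queries and coin tosses\<close>

primrec preplicate :: "nat \<Rightarrow> ('v, 'a) program \<Rightarrow> ('v, 'a list) program" where
  "preplicate 0 P = pret []"
| "preplicate (Suc t) P = pbind P (\<lambda>x. pbind (preplicate t P) (\<lambda>xs. pret (x # xs)))"

lemma implements_preplicate:
  assumes "implements Q V E P D c"
  shows "implements Q V E (preplicate t P) (replicate_pmf t D) (t * c)"
proof (induction t)
  case (Suc t)
  have "implements Q V E (preplicate (Suc t) P)
      (bind_pmf D (\<lambda>x. map_pmf (\<lambda>xs. x # xs) (replicate_pmf t D))) (c + t * c)"
    unfolding preplicate.simps by (intro implements_pbind assms implements_map Suc)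
  then show ?case
    by (simp add: map_pmf_def)
qed (simp add: implements_pret)

definition ask :: "'v query \<Rightarrow> ('v, 'v answer) program" where
  "ask q = Ask q"

text \<open>Writing the response as \<open>spmf_of_pmf p\<close> asserts that the query is answered
  with probability 1; losslessness of whole runs rests on this.\<close>

lemma implements_ask:
  assumes "q \<in> Q" "respond V E q = spmf_of_pmf p"
  shows "implements Q V E (ask q) p (cost q)"
  unfolding implements_def ask_def
proof (intro exI conjI allI)
  let ?M = "map_pmf (\<lambda>a. (a, cost q)) p"
  show "map_pmf fst ?M = p" by (simp add: pmf.map_comp o_def)
  show "\<forall>x\<in>set_pmf ?M. snd x \<le> cost q" by auto
  show "run Q V E (Ask q k) = bind_spmf (spmf_of_pmf ?M)
        (\<lambda>x. map_spmf (apsnd ((+) (snd x))) (run Q V E (k (fst x))))" for k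
    using assms by (simp add: run_Ask bind_spmf_of_pmf bind_map_pmf)
qed

definition pick :: "'a pmf \<Rightarrow> ('v, 'a) program" where
  "pick p = (\<lambda>k. Choose (map_pmf k p))"

lemma implements_pick: "implements Q V E (pick p) p 0"
  unfolding implements_def pick_def
proof (intro exI conjI allI)
  let ?M = "map_pmf (\<lambda>a. (a, 0 :: nat)) p"
  show "map_pmf fst ?M = p" by (simp add: pmf.map_comp o_def)
  show "\<forall>x\<in>set_pmf ?M. snd x \<le> 0" by auto
  show "run Q V E (Choose (map_pmf k p)) = bind_spmf (spmf_of_pmf ?M)
        (\<lambda>x. map_spmf (apsnd ((+) (snd x))) (run Q V E (k (fst x))))" for k
    by (simp add: run_Choose bind_map_pmf)
qed

fun number :: "'v answer \<Rightarrow> nat" where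
  "number (Number k) = k"
| "number (Truth b) = of_bool b"
| "number _ = 0"

fun the_vertex :: "'v answer \<Rightarrow> 'v" where
  "the_vertex (Vertex v) = v"

fun the_edge :: "'v answer \<Rightarrow> 'v set" where
  "the_edge (Edge e) = e"

text \<open>Shared by both oracles: once the samples are fixed, the pair statistic is a linear
  combination of deterministic \<open>PairQuery\<close> or \<open>Additive\<close> answers.\<close>

primrec lincomb :: "('v query \<times> real) list \<Rightarrow> ('v, real) program" where
  "lincomb [] = pret 0"
| "lincomb (qc # qcs) = pbind (ask (fst qc)) (\<lambda>a. pbind (lincomb qcs)
     (\<lambda>s. pret (snd qc * real (number a) + s)))"

lemma implements_lincomb:
  assumes "\<And>q c. (q, c) \<in> set qcs \<Longrightarrow> q \<in> Q \<and> respond V E q = return_spmf (ans q)"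
  shows "implements Q V E (lincomb qcs)
    (return_pmf (\<Sum>(q, c)\<leftarrow>qcs. c * real (number (ans q)))) (\<Sum>(q, c)\<leftarrow>qcs. cost q)"
  using assms
proof (induction qcs)
  case (Cons qc qcs)
  have "implements Q V E (ask (fst qc)) (return_pmf (ans (fst qc))) (cost (fst qc))"
    using Cons.prems[of "fst qc" "snd qc"] by (intro implements_ask) auto
  then have "implements Q V E (lincomb (qc # qcs)) (bind_pmf (return_pmf (ans (fst qc)))
    (\<lambda>a. map_pmf (\<lambda>s. snd qc * real (number a) + s) (return_pmf (\<Sum>(q, c)\<leftarrow>qcs. c * real (number (ans q))))))
     (cost (fst qc) + (\<Sum>(q, c)\<leftarrow>qcs. cost q))"
    unfolding lincomb.simps
    using Cons by (intro implements_pbind implements_map) auto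
  then show ?case
    by (simp add: bind_return_pmf split_def)
qed (simp add: implements_pret)


section \<open>Sums of independent samples\<close>

abbreviation expect :: "'a pmf \<Rightarrow> ('a \<Rightarrow> real) \<Rightarrow> real" where
  "expect p \<equiv> measure_pmf.expectation p"

text \<open>The graph is finite, so all sampled quantities have finite support and integrability is
  never an issue.\<close>

lemma integrable_finite [simp]:
  "finite (set_pmf p) \<Longrightarrow> integrable (measure_pmf p) (f :: 'a \<Rightarrow> real)"
  by (rule integrable_measure_pmf_finite)

lemma expect_bind:
  assumes "finite (set_pmf p)" "\<And>x. x \<in> set_pmf p \<Longrightarrow> finite (set_pmf (f x))"
  shows "expect (bind_pmf p f) h = expect p (\<lambda>x. expect (f x) h)"
  using assms
  by (subst pmf_expectation_bind[of "set_pmf p"])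
    (auto simp: integral_measure_pmf_real[of "set_pmf p"] mult.commute)

lemma expect_mono:
  assumes "finite (set_pmf p)" "\<And>x. x \<in> set_pmf p \<Longrightarrow> f x \<le> g x"
  shows "expect p f \<le> expect p g"
  using assms by (intro integral_mono_AE) (auto simp: AE_measure_pmf_iff)

lemma expect_cong:
  assumes "\<And>x. x \<in> set_pmf p \<Longrightarrow> f x = g x"
  shows "expect p f = expect p g"
  using assms by (intro integral_cong_AE) (auto simp: AE_measure_pmf_iff)

lemma finite_set_replicate_pmf [simp]:
  "finite (set_pmf p) \<Longrightarrow> finite (set_pmf (replicate_pmf k p))"
  by (induction k) auto

lemma expect_replicate_Suc:
  assumes "finite (set_pmf p)"
  shows "expect (replicate_pmf (Suc k) p) h =
    expect p (\<lambda>x. expect (replicate_pmf k p) (\<lambda>xs. h (x # xs)))"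
  using assms by (simp add: expect_bind)

lemma expect_sum_list:
  assumes "finite (set_pmf p)"
  shows "expect (replicate_pmf k p) (\<lambda>xs. \<Sum>x\<leftarrow>xs. f x) = k * expect p f"
  using assms
  by (induction k) (simp_all add: expect_replicate_Suc algebra_simps del: replicate_pmf.simps(2))

lemma variance_sum_list:
  assumes fin: "finite (set_pmf p)" and "expect p f = \<mu>"
  shows "expect (replicate_pmf k p) (\<lambda>xs. ((\<Sum>x\<leftarrow>xs. f x) - k * \<mu>)\<^sup>2) = k * expect p (\<lambda>x. (f x - \<mu>)\<^sup>2)"
proof (induction k)
  case (Suc k)
  let ?S = "\<lambda>xs. (\<Sum>x\<leftarrow>xs. f x) - k * \<mu>"
  let ?R = "replicate_pmf k p"
  \<comment> \<open>A centred sum has mean 0, which removes the cross term with the new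
    sample.\<close>
  have S0: "expect ?R ?S = 0"
    using assms expect_sum_list[OF fin, of k f] by simp
  have "expect (replicate_pmf (Suc k) p) (\<lambda>xs. ((\<Sum>x\<leftarrow>xs. f x) - Suc k * \<mu>)\<^sup>2)
    = expect p (\<lambda>x. expect ?R (\<lambda>xs. (f x - \<mu>)\<^sup>2 + 2 * (f x - \<mu>) * ?S xs + (?S xs)\<^sup>2))"
    using fin by (simp add: expect_replicate_Suc power2_eq_square algebra_simps del: replicate_pmf.simps(2))
  also have "\<dots> = expect p (\<lambda>x. (f x - \<mu>)\<^sup>2 + 2 * (f x - \<mu>) * expect ?R ?S + expect ?R (\<lambda>xs. (?S xs)\<^sup>2))"
    using fin by (intro expect_cong) (simp del: Bochner_Integration.integral_diff)
  also have "\<dots> = expect p (\<lambda>x. (f x - \<mu>)\<^sup>2) + k * expect p (\<lambda>x. (f x - \<mu>)\<^sup>2)"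
    unfolding S0 Suc using fin by simp
  finally show ?case by (simp add: algebra_simps)
qed simp

lemma second_moment_eq:
  assumes fin: "finite (set_pmf p)" and "expect p f = \<mu>"
  shows "expect p (\<lambda>x. (f x)\<^sup>2) = expect p (\<lambda>x. (f x - \<mu>)\<^sup>2) + \<mu>\<^sup>2"
proof -
  have "expect p (\<lambda>x. (f x - \<mu>)\<^sup>2) = expect p (\<lambda>x. (f x)\<^sup>2 - 2 * \<mu> * f x + \<mu>\<^sup>2)"
    by (simp add: power2_eq_square algebra_simps)
  also have "\<dots> = expect p (\<lambda>x. (f x)\<^sup>2) - 2 * \<mu> * expect p f + \<mu>\<^sup>2"
    using fin by simp
  finally show ?thesis
    using assms by (simp add: power2_eq_square)
qed

lemma variance_le_second_moment:
  assumes "finite (set_pmf p)" "expect p f = \<mu>"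
  shows "expect p (\<lambda>x. (f x - \<mu>)\<^sup>2) \<le> expect p (\<lambda>x. (f x)\<^sup>2)"
  using second_moment_eq[OF assms] by simp

lemma second_moment_sum_list:
  assumes fin: "finite (set_pmf p)"
  shows "expect (replicate_pmf k p) (\<lambda>xs. (\<Sum>x\<leftarrow>xs. f x)\<^sup>2)
    \<le> k * expect p (\<lambda>x. (f x)\<^sup>2) + (real k)\<^sup>2 * (expect p f)\<^sup>2"
proof -
  have "expect (replicate_pmf k p) (\<lambda>xs. (\<Sum>x\<leftarrow>xs. f x)\<^sup>2)
    = k * expect p (\<lambda>x. (f x - expect p f)\<^sup>2) + (k * expect p f)\<^sup>2"
    using second_moment_eq[OF finite_set_replicate_pmf[OF fin] expect_sum_list[OF fin]]
      variance_sum_list[OF fin refl] by simp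
  also have "\<dots> \<le> k * expect p (\<lambda>x. (f x)\<^sup>2) + (k * expect p f)\<^sup>2"
    using variance_le_second_moment[OF fin refl] by (intro add_mono mult_left_mono) auto
  finally show ?thesis by (simp add: power_mult_distrib)
qed

lemma expect_swap:
  fixes h :: "'a \<Rightarrow> 'b \<Rightarrow> real"
  assumes "finite (set_pmf p)" "finite (set_pmf q)"
  shows "expect p (\<lambda>x. expect q (\<lambda>y. h x y)) = expect q (\<lambda>y. expect p (\<lambda>x. h x y))"
proof -
  note P = integral_measure_pmf_real[OF assms(1)] and Q = integral_measure_pmf_real[OF assms(2)]
  have "expect p (\<lambda>x. expect q (\<lambda>y. h x y)) = (\<Sum>x\<in>set_pmf p. (\<Sum>y\<in>set_pmf q. h x y * pmf q y) * pmf p x)"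
    by (simp add: P Q)
  also have "\<dots> = (\<Sum>x\<in>set_pmf p. \<Sum>y\<in>set_pmf q. h x y * pmf p x * pmf q y)"
    by (simp add: sum_distrib_left mult_ac)
  also have "\<dots> = (\<Sum>y\<in>set_pmf q. \<Sum>x\<in>set_pmf p. h x y * pmf p x * pmf q y)"
    by (rule sum.swap)
  also have "\<dots> = (\<Sum>y\<in>set_pmf q. (\<Sum>x\<in>set_pmf p. h x y * pmf p x) * pmf q y)"
    by (simp add: sum_distrib_left mult_ac)
  also have "\<dots> = expect q (\<lambda>y. expect p (\<lambda>x. h x y))"
    by (simp add: P Q)
  finally show ?thesis .
qed

lemma expect_pair:
  assumes "finite (set_pmf p)" "finite (set_pmf q)"
  shows "expect (pair_pmf p q) h = expect p (\<lambda>x. expect q (\<lambda>y. h (x, y)))"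
  using assms by (simp add: pair_pmf_def expect_bind)

text \<open>Conditioned on the second sample, the double sum is a sum of independent terms in the first
  one. Its conditional mean is a sum of independent terms in the second one, which splits the
  variance into two orthogonal parts.\<close>

lemma variance_double_sum:
  fixes \<phi> :: "'a \<Rightarrow> 'b \<Rightarrow> real"
  assumes fin: "finite (set_pmf p)" "finite (set_pmf q)"
    and \<mu>: "expect p (\<lambda>x. expect q (\<phi> x)) = \<mu>"
    and \<sigma>: "expect p (\<lambda>x. expect q (\<lambda>y. (\<phi> x y)\<^sup>2)) \<le> \<sigma>"
    and b1: "\<And>x. x \<in> set_pmf p \<Longrightarrow> \<bar>expect q (\<phi> x)\<bar> \<le> b"
    and b2: "\<And>y. y \<in> set_pmf q \<Longrightarrow> \<bar>expect p (\<lambda>x. \<phi> x y)\<bar> \<le> b"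
  shows "expect (pair_pmf (replicate_pmf k p) (replicate_pmf k q))
      (\<lambda>(xs, ys). ((\<Sum>x\<leftarrow>xs. \<Sum>y\<leftarrow>ys. \<phi> x y) - (real k)\<^sup>2 * \<mu>)\<^sup>2) \<le> (real k)\<^sup>2 * \<sigma> + 2 * real k ^ 3 * b\<^sup>2"
proof -
  let ?P = "replicate_pmf k p" and ?Q = "replicate_pmf k q"
  let ?S = "\<lambda>xs ys. \<Sum>x\<leftarrow>xs. \<Sum>y\<leftarrow>ys. \<phi> x y"
  let ?F = "\<lambda>ys x. \<Sum>y\<leftarrow>ys. \<phi> x y"
  let ?G = "\<lambda>y. expect p (\<lambda>x. \<phi> x y)"
  have finR: "finite (set_pmf ?P)" "finite (set_pmf ?Q)"
    using fin by auto
  have EF: "expect p (?F ys) = (\<Sum>y\<leftarrow>ys. ?G y)" for ys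
    using fin by (induction ys) auto
  have sq_le: "(expect q (\<phi> x))\<^sup>2 \<le> b\<^sup>2" if "x \<in> set_pmf p" for x
    using b1[OF that] by (metis abs_ge_zero power2_abs power_mono)
  have sq_le2: "(?G y)\<^sup>2 \<le> b\<^sup>2" if "y \<in> set_pmf q" for y
    using b2[OF that] by (metis abs_ge_zero power2_abs power_mono)
  \<comment> \<open>For fixed \<open>ys\<close> the terms in \<open>xs\<close> are independent with
    mean \<open>?m\<close>, so the squared deviation is a variance plus the squared bias of the
    conditional mean.\<close>
  have cond: "expect ?P (\<lambda>xs. (?S xs ys - (real k)\<^sup>2 * \<mu>)\<^sup>2)
     = k * expect p (\<lambda>x. (?F ys x - (\<Sum>y\<leftarrow>ys. ?G y))\<^sup>2) + (real k)\<^sup>2 * ((\<Sum>y\<leftarrow>ys. ?G y) - k * \<mu>)\<^sup>2" for ys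
  proof -
    let ?m = "\<Sum>y\<leftarrow>ys. ?G y"
    have 1: "expect ?P (\<lambda>xs. ?S xs ys - (real k)\<^sup>2 * \<mu>) = k * ?m - (real k)\<^sup>2 * \<mu>"
      using fin(1) finR expect_sum_list[OF fin(1), of k "?F ys"] EF[of ys] by simp
    have "expect ?P (\<lambda>xs. (?S xs ys - (real k)\<^sup>2 * \<mu>)\<^sup>2)
       = expect ?P (\<lambda>xs. (?S xs ys - (real k)\<^sup>2 * \<mu> - (k * ?m - (real k)\<^sup>2 * \<mu>))\<^sup>2) + (k * ?m - (real k)\<^sup>2 * \<mu>)\<^sup>2"
      by (rule second_moment_eq[OF finR(1) 1])
    also have "(\<lambda>xs. (?S xs ys - (real k)\<^sup>2 * \<mu> - (k * ?m - (real k)\<^sup>2 * \<mu>))\<^sup>2) = (\<lambda>xs. (?S xs ys - k * ?m)\<^sup>2)"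
      by simp
    also have "expect ?P \<dots> = k * expect p (\<lambda>x. (?F ys x - ?m)\<^sup>2)"
      by (rule variance_sum_list[OF fin(1) EF])
    also have "(k * ?m - (real k)\<^sup>2 * \<mu>)\<^sup>2 = (real k)\<^sup>2 * (?m - k * \<mu>)\<^sup>2"
      by (simp add: power2_eq_square algebra_simps)
    finally show ?thesis .
  qed
  have "expect (pair_pmf ?P ?Q) (\<lambda>(xs, ys). (?S xs ys - (real k)\<^sup>2 * \<mu>)\<^sup>2)
     = expect ?Q (\<lambda>ys. expect ?P (\<lambda>xs. (?S xs ys - (real k)\<^sup>2 * \<mu>)\<^sup>2))"
    using finR by (simp add: expect_pair expect_swap[of ?P ?Q])
  also have "\<dots> = k * expect ?Q (\<lambda>ys. expect p (\<lambda>x. (?F ys x - (\<Sum>y\<leftarrow>ys. ?G y))\<^sup>2))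
      + (real k)\<^sup>2 * expect ?Q (\<lambda>ys. ((\<Sum>y\<leftarrow>ys. ?G y) - k * \<mu>)\<^sup>2)"
    unfolding cond using finR by simp
  \<comment> \<open>Passing to second moments allows the expectations to be exchanged; for fixed
    \<open>x\<close> the sum over \<open>ys\<close> is again a sum of independent terms.\<close>
  also have "expect ?Q (\<lambda>ys. expect p (\<lambda>x. (?F ys x - (\<Sum>y\<leftarrow>ys. ?G y))\<^sup>2))
      \<le> expect ?Q (\<lambda>ys. expect p (\<lambda>x. (?F ys x)\<^sup>2))"
    by (intro expect_mono finR variance_le_second_moment fin EF)
  also have "\<dots> = expect p (\<lambda>x. expect ?Q (\<lambda>ys. (?F ys x)\<^sup>2))"
    by (intro expect_swap fin finR)
  also have "\<dots> \<le> expect p (\<lambda>x. k * expect q (\<lambda>y. (\<phi> x y)\<^sup>2) + (real k)\<^sup>2 * (expect q (\<phi> x))\<^sup>2)"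
    using second_moment_sum_list[OF fin(2), of k] by (intro expect_mono fin) simp
  also have "\<dots> = k * expect p (\<lambda>x. expect q (\<lambda>y. (\<phi> x y)\<^sup>2)) + (real k)\<^sup>2 * expect p (\<lambda>x. (expect q (\<phi> x))\<^sup>2)"
    using fin by simp
  also have "expect p (\<lambda>x. (expect q (\<phi> x))\<^sup>2) \<le> expect p (\<lambda>x. b\<^sup>2)"
    by (intro expect_mono fin sq_le)
  also have "expect ?Q (\<lambda>ys. ((\<Sum>y\<leftarrow>ys. ?G y) - k * \<mu>)\<^sup>2) = k * expect q (\<lambda>y. (?G y - \<mu>)\<^sup>2)"
    using fin \<mu> by (intro variance_sum_list) (simp_all add: expect_swap[of p q])
  also have "expect q (\<lambda>y. (?G y - \<mu>)\<^sup>2) \<le> expect q (\<lambda>y. (?G y)\<^sup>2)"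
    using fin \<mu> by (intro variance_le_second_moment) (simp_all add: expect_swap[of p q])
  also have "\<dots> \<le> expect q (\<lambda>y. b\<^sup>2)"
    by (intro expect_mono fin sq_le2)
  also have "expect p (\<lambda>x. expect q (\<lambda>y. (\<phi> x y)\<^sup>2)) \<le> \<sigma>" by (rule \<sigma>)
  finally have "expect (pair_pmf ?P ?Q) (\<lambda>(xs, ys). (?S xs ys - (real k)\<^sup>2 * \<mu>)\<^sup>2)
     \<le> k * (k * \<sigma> + (real k)\<^sup>2 * b\<^sup>2) + (real k)\<^sup>2 * (k * b\<^sup>2)"
    by (simp add: mult_left_mono add_mono)
  also have "\<dots> = (real k)\<^sup>2 * \<sigma> + 2 * real k ^ 3 * b\<^sup>2"
    by (simp add: power2_eq_square power3_eq_cube algebra_simps)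
  finally show ?thesis .
qed

text \<open>Chebyshev's inequality: on the bad event the squared deviation of the sum is at least
  \<open>(k * t)\<^sup>2\<close>, and \<open>variance_sum_list\<close> gives its mean.\<close>

lemma chebyshev_average:
  assumes fin: "finite (set_pmf X)" and \<mu>: "expect X f = \<mu>"
    and v: "expect X (\<lambda>x. (f x - \<mu>)\<^sup>2) \<le> v" and "t > 0" "k > 0"
  shows "measure (measure_pmf (replicate_pmf k X)) {xs. \<bar>(\<Sum>x\<leftarrow>xs. f x) / k - \<mu>\<bar> > t} \<le> v / (k * t\<^sup>2)"
proof -
  let ?R = "replicate_pmf k X"
  let ?B = "{xs. \<bar>(\<Sum>x\<leftarrow>xs. f x) / k - \<mu>\<bar> > t}"
  have "measure (measure_pmf ?R) ?B * (k * t)\<^sup>2 = expect ?R (\<lambda>xs. indicator ?B xs * (k * t)\<^sup>2)"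
    using fin by simp
  also have "\<dots> \<le> expect ?R (\<lambda>xs. ((\<Sum>x\<leftarrow>xs. f x) - k * \<mu>)\<^sup>2)"
  proof (intro expect_mono finite_set_replicate_pmf fin)
    fix xs
    show "indicator ?B xs * (k * t)\<^sup>2 \<le> ((\<Sum>x\<leftarrow>xs. f x) - k * \<mu>)\<^sup>2"
    proof (cases "xs \<in> ?B")
      case True
      have "\<bar>k * t\<bar> \<le> k * \<bar>(\<Sum>x\<leftarrow>xs. f x) / k - \<mu>\<bar>"
        using True \<open>t > 0\<close> by (simp add: mult_left_mono)
      also have "\<dots> = \<bar>k * ((\<Sum>x\<leftarrow>xs. f x) / k - \<mu>)\<bar>"
        by (simp add: abs_mult)
      also have "\<dots> = \<bar>(\<Sum>x\<leftarrow>xs. f x) - k * \<mu>\<bar>"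
        using \<open>k > 0\<close> by (simp add: algebra_simps)
      finally show ?thesis
        using True by (simp add: abs_le_square_iff[symmetric])
    qed simp
  qed
  also have "\<dots> = k * expect X (\<lambda>x. (f x - \<mu>)\<^sup>2)"
    by (rule variance_sum_list[OF fin \<mu>])
  also have "\<dots> \<le> k * v"
    using v by (intro mult_left_mono) auto
  finally show ?thesis
    using \<open>t > 0\<close> \<open>k > 0\<close> by (simp add: field_simps power2_eq_square)
qed


section \<open>Sampling vertices and arcs\<close>

text \<open>The weight of a heavy vertex is \<open>1 / deg v\<close>, scaled by \<open>n\<close> and rounded to a natural number, so
  that it can be decomposed into bits when pairs are counted with Additive. The rounding loses at
  most a factor 2 and is the same in \<open>heavy\<close> and \<open>pair_kernel\<close>, hence cancels in their ratio.\<close>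

definition weight :: "nat \<Rightarrow> real \<Rightarrow> nat \<Rightarrow> nat" where
  "weight n \<theta> k = (if real k \<le> \<theta> then 0 else n div k)"

lemma weight_le: "real k * real (weight n \<theta> k) \<le> real n"
proof -
  have "k * weight n \<theta> k \<le> n" by (simp add: weight_def)
  then show ?thesis by (metis of_nat_le_iff of_nat_mult)
qed

text \<open>For \<open>k \<le> n\<close> the quotient is at least 1, so the remainder is below
  \<open>k \<le> k * (n div k)\<close>.\<close>

lemma weight_ge:
  assumes "real k > \<theta>" "1 \<le> k" "k \<le> n"
  shows "real n \<le> 2 * (real k * real (weight n \<theta> k))"
proof -
  have "n mod k < k" "n = k * (n div k) + n mod k" "n div k \<ge> 1"
    using assms by (auto simp: div_greater_zero_iff Suc_le_eq)
  moreover from this have "k \<le> k * (n div k)" by simp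
  ultimately have "n \<le> 2 * (k * (n div k))" by linarith
  then have "real n \<le> real (2 * (k * (n div k)))" by (rule of_nat_mono)
  then show ?thesis using assms by (simp add: weight_def)
qed

text \<open>Only the first endpoints of the two arcs matter. Up to rounding, adjacent heavy vertices
  \<open>u\<close> and \<open>v\<close> get \<open>n / (deg u * deg v)\<close>, inversely
  proportional to the probability of drawing that pair.\<close>

definition pair_kernel ::
  "'v set set \<Rightarrow> nat \<Rightarrow> real \<Rightarrow> ('v \<times> nat) \<times> ('v \<times> nat) \<Rightarrow> ('v \<times> nat) \<times> ('v \<times> nat) \<Rightarrow> real" where
  "pair_kernel E n \<theta> x y = of_bool ({fst (fst x), fst (fst y)} \<in> E)
     * real (weight n \<theta> (snd (fst x))) * real (weight n \<theta> (snd (fst y))) / real n"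

definition light :: "real \<Rightarrow> ('v \<times> nat) \<times> ('v \<times> nat) \<Rightarrow> real" where
  "light \<theta> x = of_bool (real (snd (fst x)) \<le> \<theta>)"

text \<open>A soft indicator of two heavy endpoints: zero if one is light and otherwise between 1/4
  and 1, for degrees from 1 to \<open>n\<close>.\<close>

definition heavy :: "nat \<Rightarrow> real \<Rightarrow> ('v \<times> nat) \<times> ('v \<times> nat) \<Rightarrow> real" where
  "heavy n \<theta> x = real (snd (fst x)) * real (weight n \<theta> (snd (fst x))) / real n
     * (real (snd (snd x)) * real (weight n \<theta> (snd (snd x))) / real n)"

text \<open>The cut at \<theta> keeps the second moment linear in \<theta>; a few vertices of large
  degree would otherwise dominate it.\<close>

definition light_degree :: "real \<Rightarrow> 'v \<times> nat \<Rightarrow> real" where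
  "light_degree \<theta> x = (if real (snd x) \<le> \<theta> then real (snd x) else 0)"

definition with_degree :: "'v \<Rightarrow> ('v, 'v \<times> nat) program" where
  "with_degree v = pbind (ask (Degree v)) (\<lambda>a. pret (v, number a))"

definition sample_vertex :: "('v, 'v \<times> nat) program" where
  "sample_vertex = pbind (ask RandVert) (\<lambda>a. with_degree (the_vertex a))"

text \<open>A random orientation of a random edge is a uniform arc, whose first endpoint is
  distributed proportionally to degree.\<close>

definition sample_arc :: "('v, ('v \<times> nat) \<times> ('v \<times> nat)) program" where
  "sample_arc = pbind (ask RandEdge) (\<lambda>a. pbind (pick (pmf_of_set {(u, v). {u, v} = the_edge a}))
     (\<lambda>(u, v). pbind (with_degree u) (\<lambda>x. pbind (with_degree v) (\<lambda>y. pret (x, y)))))"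

locale input =
  fixes V :: "'v set" and E :: "'v set set"
  assumes graph: "input_graph V E"
begin

definition n :: nat where "n = card V"

definition d :: real where "d = average_degree V E"

definition deg :: "'v \<Rightarrow> nat" where "deg x = card (neighbors E x)"

definition arcs :: "('v \<times> 'v) set" where "arcs = {(u, v). {u, v} \<in> E}"

section \<open>Degrees, arcs and double counting\<close>

lemma finite_V [simp]: "finite V" and V_nonempty [simp]: "V \<noteq> {}"
  and edge_subset: "e \<in> E \<Longrightarrow> e \<subseteq> V" and card_edge: "e \<in> E \<Longrightarrow> card e = 2"
  and neighbors_nonempty: "x \<in> V \<Longrightarrow> neighbors E x \<noteq> {}"
  using graph by (auto simp: input_graph_def simple_graph_def no_isolated_vertices_def)

lemma finite_E [simp]: "finite E"
  by (rule finite_subset[of _ "Pow V"]) (use edge_subset in auto)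

lemma neighbors_subset: "neighbors E x \<subseteq> V"
  using edge_subset by (auto simp: neighbors_def)

lemma finite_neighbors [simp]: "finite (neighbors E x)"
  using neighbors_subset finite_V by (rule finite_subset)

lemma E_nonempty [simp]: "E \<noteq> {}"
  using neighbors_nonempty V_nonempty by (fastforce simp: neighbors_def)

lemma n_pos [simp]: "n > 0"
  by (simp add: n_def card_gt_0_iff)

lemma deg_pos: "x \<in> V \<Longrightarrow> deg x \<ge> 1"
  using neighbors_nonempty by (simp add: deg_def Suc_le_eq card_gt_0_iff)

lemma deg_le: "deg x \<le> n"
  unfolding deg_def n_def by (intro card_mono neighbors_subset) auto

lemma arcs_Sigma: "arcs = Sigma V (neighbors E)"
  using edge_subset by (auto simp: arcs_def neighbors_def)

lemma finite_arcs [simp]: "finite arcs"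
  by (simp add: arcs_Sigma)

lemma arcs_in_V: "(u, v) \<in> arcs \<Longrightarrow> u \<in> V" "(u, v) \<in> arcs \<Longrightarrow> v \<in> V"
  using edge_subset by (auto simp: arcs_def)

lemma sum_arcs: "(\<Sum>(u, v)\<in>arcs. F u v) = (\<Sum>u\<in>V. \<Sum>v\<in>neighbors E u. F u v)"
  by (simp add: arcs_Sigma sum.Sigma)

lemma sum_arcs_fst: "(\<Sum>(u, v)\<in>arcs. F u) = (\<Sum>u\<in>V. real (deg u) * F u)"
  by (simp add: sum_arcs deg_def)

lemma sum_arcs_swap: "(\<Sum>(u, v)\<in>arcs. F v u) = (\<Sum>(u, v)\<in>arcs. F u v)"
  by (rule sum.reindex_bij_witness[of _ prod.swap prod.swap]) (auto simp: arcs_def insert_commute)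

lemma orientations:
  assumes "card e = 2"
  shows "finite {(u, v). {u, v} = e}" "card {(u, v). {u, v} = e} = 2"
proof -
  obtain x y where e: "e = {x, y}" "x \<noteq> y"
    using assms by (auto simp: card_2_iff)
  then have "{(u, v). {u, v} = e} = {(x, y), (y, x)}"
    by (auto simp: doubleton_eq_iff)
  then show "finite {(u, v). {u, v} = e}" "card {(u, v). {u, v} = e} = 2"
    using e by auto
qed

text \<open>Different edges have disjoint pairs of orientations. Applied to \<open>E\<close> this
  counts the arcs; applied to the edges inside a set it links answers of \<open>Additive\<close> to
  ordered adjacent pairs.\<close>

lemma card_orientations:
  assumes "F \<subseteq> E"
  shows "card {(u, v). {u, v} \<in> F} = 2 * card F"
proof -
  have F: "finite F" using assms by (rule finite_subset) simp
  have "{(u, v). {u, v} \<in> F} = (\<Union>e\<in>F. {(u, v). {u, v} = e})" by auto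
  also have "card \<dots> = (\<Sum>e\<in>F. card {(u, v). {u, v} = e})"
    using assms F by (intro card_UN_disjoint) (auto intro: orientations card_edge)
  also have "\<dots> = (\<Sum>e\<in>F. 2)"
    using assms by (intro sum.cong refl orientations card_edge) auto
  finally show ?thesis by simp
qed

lemma card_arcs: "real (card arcs) = real n * d"
  using card_orientations[of E] by (simp add: arcs_def d_def average_degree_def n_def)

lemma arcs_nonempty [simp]: "arcs \<noteq> {}"
proof -
  obtain v where "v \<in> V" using V_nonempty by blast
  then show ?thesis using neighbors_nonempty[of v] by (auto simp: arcs_Sigma)
qed

text \<open>Without isolated vertices all degrees are at least 1. The search relies on this to end
  at a depth determined by \<open>n\<close> alone.\<close>

lemma d_ge_1: "d \<ge> 1"
proof -
  have "real n \<le> (\<Sum>u\<in>V. real (deg u) * 1)"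
    using sum_mono[of V "\<lambda>_. 1" "\<lambda>u. real (deg u)"] deg_pos by (auto simp: n_def Suc_le_eq)
  also have "\<dots> = real n * d"
    by (subst sum_arcs_fst[symmetric]) (simp add: card_arcs)
  finally show ?thesis by simp
qed

lemma d_pos [simp]: "d > 0"
  using d_ge_1 by linarith

lemma d_nonneg [simp]: "0 \<le> d" and d_nonzero [simp]: "d \<noteq> 0" and n_nonzero [simp]: "n \<noteq> 0"
  using d_pos n_pos by linarith+

lemma d_le_n: "d \<le> n"
proof -
  have "real n * d = (\<Sum>u\<in>V. real (deg u) * 1)"
    by (subst sum_arcs_fst[symmetric]) (simp add: card_arcs)
  also have "\<dots> \<le> (\<Sum>u\<in>V. real n)"
    using deg_le by (intro sum_mono) auto
  finally show ?thesis by (simp add: n_def[symmetric])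
qed

section \<open>Distributions of sampled vertices and arcs\<close>

definition vertex_pmf :: "('v \<times> nat) pmf" where
  "vertex_pmf = map_pmf (\<lambda>v. (v, deg v)) (pmf_of_set V)"

definition arc_pmf :: "(('v \<times> nat) \<times> ('v \<times> nat)) pmf" where
  "arc_pmf = map_pmf (\<lambda>(u, v). ((u, deg u), (v, deg v))) (pmf_of_set arcs)"

lemma set_vertex_pmf: "set_pmf vertex_pmf = (\<lambda>v. (v, deg v)) ` V"
  by (simp add: vertex_pmf_def)

lemma set_arc_pmf: "set_pmf arc_pmf = (\<lambda>(u, v). ((u, deg u), (v, deg v))) ` arcs"
  by (simp add: arc_pmf_def)

lemma finite_pmfs [simp]: "finite (set_pmf vertex_pmf)" "finite (set_pmf arc_pmf)"
  by (simp_all add: set_vertex_pmf set_arc_pmf)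

lemma expect_vertex: "expect vertex_pmf h = (\<Sum>v\<in>V. h (v, deg v)) / n"
  by (simp add: vertex_pmf_def integral_pmf_of_set n_def)

lemma expect_arc: "expect arc_pmf h = (\<Sum>(u, v)\<in>arcs. h ((u, deg u), (v, deg v))) / (n * d)"
  by (simp add: arc_pmf_def integral_pmf_of_set card_arcs split_def)

text \<open>The arcs are grouped by their first endpoint, which is \<open>u\<close> in exactly
  \<open>deg u\<close> of the \<open>n * d\<close> arcs.\<close>

lemma expect_arc_fst: "expect arc_pmf (\<lambda>x. h (fst x)) = (\<Sum>u\<in>V. real (deg u) * h (u, deg u)) / (n * d)"
  unfolding expect_arc sum_arcs_fst[symmetric] by (simp add: split_def)

lemma implements_with_degree:
  "base_queries \<subseteq> Q \<Longrightarrow> v \<in> V \<Longrightarrow> implements Q V E (with_degree v) (return_pmf (v, deg v)) 1"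
  using implements_map[OF implements_ask[of "Degree v" Q V E "return_pmf (Number (deg v))"],
      of "\<lambda>a. (v, number a)"]
  by (auto simp: with_degree_def base_queries_def deg_def)

lemma implements_sample_vertex:
  assumes "base_queries \<subseteq> Q"
  shows "implements Q V E sample_vertex vertex_pmf 2"
proof -
  have "implements Q V E (ask RandVert) (map_pmf Vertex (pmf_of_set V)) 1"
    using assms implements_ask[of RandVert Q V E "map_pmf Vertex (pmf_of_set V)"]
    by (simp add: base_queries_def flip: spmf_of_pmf_pmf_of_set)
  then have "implements Q V E sample_vertex
     (bind_pmf (map_pmf Vertex (pmf_of_set V)) (\<lambda>a. return_pmf (the_vertex a, deg (the_vertex a)))) (1 + 1)"
    unfolding sample_vertex_def
    by (rule implements_pbind) (auto intro!: implements_with_degree assms simp del: One_nat_def)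
  then show ?thesis
    by (simp add: vertex_pmf_def map_pmf_def bind_assoc_pmf bind_return_pmf numeral_2_eq_2)
qed

text \<open>The cost 3 is one edge and two degrees; choosing the orientation is free.\<close>

lemma implements_sample_arc:
  assumes "base_queries \<subseteq> Q"
  shows "implements Q V E sample_arc arc_pmf 3"
proof -
  have "implements Q V E (ask RandEdge) (map_pmf Edge (pmf_of_set E)) 1"
    using assms implements_ask[of RandEdge Q V E "map_pmf Edge (pmf_of_set E)"]
    by (simp add: base_queries_def flip: spmf_of_pmf_pmf_of_set)
  then have "implements Q V E sample_arc
     (bind_pmf (map_pmf Edge (pmf_of_set E)) (\<lambda>a. bind_pmf (pmf_of_set {(u, v). {u, v} = the_edge a})
       (\<lambda>(u, v). bind_pmf (return_pmf (u, deg u)) (\<lambda>x. map_pmf (\<lambda>y. (x, y)) (return_pmf (v, deg v))))))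
     (1 + (0 + (1 + 1)))"
    unfolding sample_arc_def
  proof (intro implements_pbind implements_pick)
    fix a uv
    assume a: "a \<in> set_pmf (map_pmf Edge (pmf_of_set E))"
      and uv: "uv \<in> set_pmf (pmf_of_set {(u, v). {u, v} = the_edge a})"
    obtain u v where [simp]: "uv = (u, v)" by (cases uv)
    obtain e where e: "e \<in> E" "a = Edge e" using a by auto
    note fin = orientations[OF card_edge[OF e(1)]]
    then have "{(u, v). {u, v} = e} \<noteq> {}" by (metis card.empty zero_neq_numeral)
    then have "{u, v} = e" using uv e fin by simp
    then have V: "u \<in> V" "v \<in> V" using edge_subset[OF e(1)] by auto
    have "implements Q V E (pbind (with_degree u) (\<lambda>x. pbind (with_degree v) (\<lambda>y. pret (x, y))))
      (bind_pmf (return_pmf (u, deg u)) (\<lambda>x. map_pmf (\<lambda>y. (x, y)) (return_pmf (v, deg v)))) (1 + 1)"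
      by (intro implements_pbind implements_map implements_with_degree assms V)
    then show "implements Q V E (case uv of (u, v) \<Rightarrow>
        pbind (with_degree u) (\<lambda>x. pbind (with_degree v) (\<lambda>y. pret (x, y))))
      (case uv of (u, v) \<Rightarrow> bind_pmf (return_pmf (u, deg u))
        (\<lambda>x. map_pmf (\<lambda>y. (x, y)) (return_pmf (v, deg v)))) (1 + 1)"
      by simp
  qed
  also have "bind_pmf (map_pmf Edge (pmf_of_set E)) (\<lambda>a. bind_pmf (pmf_of_set {(u, v). {u, v} = the_edge a})
       (\<lambda>(u, v). bind_pmf (return_pmf (u, deg u)) (\<lambda>x. map_pmf (\<lambda>y. (x, y)) (return_pmf (v, deg v)))))
     = map_pmf (\<lambda>(u, v). ((u, deg u), (v, deg v)))
        (bind_pmf (pmf_of_set E) (\<lambda>e. pmf_of_set {(u, v). {u, v} = e}))"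
    by (simp add: bind_map_pmf map_bind_pmf bind_return_pmf map_pmf_def split_def bind_assoc_pmf)
  \<comment> \<open>The fibres are disjoint and all of size 2, so a uniform edge with a uniform
    orientation is uniform on their union.\<close>
  also have "bind_pmf (pmf_of_set E) (\<lambda>e. pmf_of_set {(u, v). {u, v} = e})
      = pmf_of_set (\<Union>e\<in>E. {(u, v). {u, v} = e})"
    by (rule pmf_of_set_UN[symmetric, where n = 2])
      (use orientations card_edge in \<open>force simp: disjoint_family_on_def\<close>)+
  also have "(\<Union>e\<in>E. {(u, v). {u, v} = e}) = arcs"
    by (auto simp: arcs_def)
  finally show ?thesis
    by (simp add: arc_pmf_def numeral_3_eq_3)
qed

end


section \<open>Moments of the basic statistics\<close>

context input
begin

text \<open>Both \<alpha> and \<gamma> are unknown but cancel from the ratios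
  \<open>(\<alpha> \<theta> * d) / \<alpha> \<theta>\<close> and
  \<open>\<gamma> \<theta> / (\<gamma> \<theta> / d)\<close>, which equal \<open>d\<close> whenever
  their denominators do not vanish.\<close>

definition \<alpha> :: "real \<Rightarrow> real" where "\<alpha> \<theta> = expect arc_pmf (light \<theta>)"

definition \<gamma> :: "real \<Rightarrow> real" where "\<gamma> \<theta> = expect arc_pmf (heavy n \<theta>)"

abbreviation wt :: "real \<Rightarrow> 'v \<Rightarrow> real" where
  "wt \<theta> u \<equiv> real (weight n \<theta> (deg u))"

lemma deg_wt_le: "real (deg u) * wt \<theta> u / real n \<le> 1"
  using weight_le[of "deg u" n \<theta>] by simp

lemma expect_light_degree: "expect vertex_pmf (light_degree \<theta>) = \<alpha> \<theta> * d"
proof -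
  have "\<alpha> \<theta> = (\<Sum>u\<in>V. real (deg u) * of_bool (real (deg u) \<le> \<theta>)) / (n * d)"
    using expect_arc_fst[of "\<lambda>x. of_bool (real (snd x) \<le> \<theta>)"] by (simp add: \<alpha>_def light_def[abs_def])
  moreover have "real (deg u) * of_bool (real (deg u) \<le> \<theta>) = light_degree \<theta> (u, deg u)" for u
    by (simp add: light_degree_def)
  ultimately show ?thesis
    by (simp add: expect_vertex)
qed

text \<open>A light vertex satisfies \<open>(deg u)\<^sup>2 \<le> \<theta> * deg u\<close>, and the
  degrees sum to \<open>n * d\<close>.\<close>

lemma second_moment_light_degree:
  assumes "\<theta> \<ge> 0"
  shows "expect vertex_pmf (\<lambda>x. (light_degree \<theta> x)\<^sup>2) \<le> \<theta> * d"
proof -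
  have "expect vertex_pmf (\<lambda>x. (light_degree \<theta> x)\<^sup>2) \<le> (\<Sum>u\<in>V. real (deg u) * \<theta>) / n"
    unfolding expect_vertex
    using assms by (intro divide_right_mono sum_mono) (auto simp: light_degree_def power2_eq_square mult_left_mono)
  also have "\<dots> = \<theta> * d"
    by (subst sum_arcs_fst[symmetric]) (simp add: card_arcs split_def)
  finally show ?thesis .
qed

text \<open>Degree-biased sampling supplies the factors \<open>deg u\<close> and
  \<open>deg v\<close> that turn the product of weights into \<open>heavy\<close>, and adjacency
  restricts the double sum over vertices to a sum over arcs.\<close>

lemma expect_pair_kernel:
  "expect arc_pmf (\<lambda>x. expect arc_pmf (pair_kernel E n \<theta> x)) = \<gamma> \<theta> / d"
proof -
  let ?h = "\<lambda>u. real (deg u) * wt \<theta> u / n"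
  have inner: "expect arc_pmf (pair_kernel E n \<theta> ((u, k), y))
     = real (weight n \<theta> k) * (\<Sum>v\<in>neighbors E u. ?h v) / (n * d)" for u k y
  proof -
    have "(\<Sum>v\<in>V. real (deg v) * (of_bool ({u, v} \<in> E) * real (weight n \<theta> k) * wt \<theta> v / n))
      = (\<Sum>v\<in>V. if v \<in> neighbors E u then real (weight n \<theta> k) * ?h v else 0)"
      by (intro sum.cong refl) (auto simp: neighbors_def)
    also have "\<dots> = (\<Sum>v\<in>neighbors E u. real (weight n \<theta> k) * ?h v)"
      using neighbors_subset[of u] by (simp add: sum.If_cases Int_absorb1)
    finally show ?thesis
      using expect_arc_fst[of "\<lambda>z. of_bool ({u, fst z} \<in> E) * real (weight n \<theta> k) * real (weight n \<theta> (snd z)) / n"]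
      by (simp add: pair_kernel_def[abs_def] sum_distrib_left)
  qed
  have "expect arc_pmf (\<lambda>x. expect arc_pmf (pair_kernel E n \<theta> x))
     = expect arc_pmf (\<lambda>x. real (weight n \<theta> (snd (fst x))) * (\<Sum>v\<in>neighbors E (fst (fst x)). ?h v) / (n * d))"
    using inner[of "fst (fst x)" "snd (fst x)" "snd x" for x] by (intro expect_cong) simp
  also have "\<dots> = (\<Sum>u\<in>V. real (deg u) * (wt \<theta> u * (\<Sum>v\<in>neighbors E u. ?h v) / (n * d))) / (n * d)"
    by (rule expect_arc_fst[of "\<lambda>z. real (weight n \<theta> (snd z)) * (\<Sum>v\<in>neighbors E (fst z). ?h v) / (n * d)", simplified fst_conv snd_conv])
  also have "\<dots> = (\<Sum>u\<in>V. (\<Sum>v\<in>neighbors E u. ?h u * ?h v)) / (n * d) / d"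
    by (simp add: sum_divide_distrib sum_distrib_left field_simps)
  also have "\<dots> = \<gamma> \<theta> / d"
    by (simp add: \<gamma>_def expect_arc heavy_def sum_arcs)
  finally show ?thesis .
qed

lemma pair_kernel_commute: "pair_kernel E n \<theta> x y = pair_kernel E n \<theta> y x"
  by (simp add: pair_kernel_def insert_commute mult_ac)

text \<open>Each of the \<open>deg u\<close> neighbours contributes at most
  \<open>wt \<theta> u\<close>, and \<open>weight_le\<close> bounds the total by \<open>n\<close>.
  In \<open>variance_double_sum\<close> this controls the correlation of pairs that share an
  arc.\<close>

lemma expect_pair_kernel_le:
  assumes "x \<in> set_pmf arc_pmf"
  shows "\<bar>expect arc_pmf (pair_kernel E n \<theta> x)\<bar> \<le> 1 / d"
proof -
  obtain u v where x: "x = ((u, deg u), (v, deg v))" "(u, v) \<in> arcs"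
    using assms by (auto simp: set_arc_pmf)
  have "expect arc_pmf (pair_kernel E n \<theta> x)
      = (\<Sum>v\<in>V. real (deg v) * (of_bool ({u, v} \<in> E) * wt \<theta> u * wt \<theta> v / n)) / (n * d)"
    using expect_arc_fst[of "\<lambda>z. of_bool ({u, fst z} \<in> E) * wt \<theta> u * real (weight n \<theta> (snd z)) / n"]
    by (simp add: pair_kernel_def[abs_def] x)
  moreover have "0 \<le> (\<Sum>v\<in>V. real (deg v) * (of_bool ({u, v} \<in> E) * wt \<theta> u * wt \<theta> v / n))"
    by (intro sum_nonneg) auto
  moreover have "(\<Sum>v\<in>V. real (deg v) * (of_bool ({u, v} \<in> E) * wt \<theta> u * wt \<theta> v / n)) \<le> n"
  proof -
    have "(\<Sum>v\<in>V. real (deg v) * (of_bool ({u, v} \<in> E) * wt \<theta> u * wt \<theta> v / n))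
      \<le> (\<Sum>v\<in>V. if v \<in> neighbors E u then wt \<theta> u else 0)"
      using mult_left_mono[OF deg_wt_le, of "wt \<theta> u"]
      by (intro sum_mono) (auto simp: neighbors_def mult_ac)
    also have "\<dots> = deg u * wt \<theta> u"
      using neighbors_subset[of u] by (simp add: sum.If_cases Int_absorb1 deg_def)
    also have "\<dots> \<le> n" by (rule weight_le)
    finally show ?thesis .
  qed
  ultimately have "expect arc_pmf (pair_kernel E n \<theta> x) \<ge> 0"
    "expect arc_pmf (pair_kernel E n \<theta> x) \<le> n / (n * d)"
    by (simp_all only: divide_right_mono divide_nonneg_nonneg of_nat_0_le_iff mult_nonneg_nonneg d_nonneg)
  then show ?thesis by simp
qed

text \<open>Squaring leaves one surplus weight per endpoint, and each is at most
  \<open>n / \<theta>\<close> because light vertices have weight 0 and heavy ones have degree above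
  \<theta>.\<close>

lemma second_moment_pair_kernel:
  assumes "\<theta> > 0"
  shows "expect arc_pmf (\<lambda>x. expect arc_pmf (\<lambda>y. (pair_kernel E n \<theta> x y)\<^sup>2)) \<le> n / (\<theta>\<^sup>2 * d)"
proof -
  have wt_le: "wt \<theta> u \<le> n / \<theta>" for u
  proof (cases "real (deg u) \<le> \<theta>")
    case False
    then have "\<theta> * wt \<theta> u \<le> real (deg u) * wt \<theta> u"
      by (intro mult_right_mono) auto
    also have "\<dots> \<le> n" by (rule weight_le)
    finally show ?thesis using assms by (simp add: field_simps)
  qed (use assms in \<open>simp add: weight_def\<close>)
  have *: "real (deg u) * (wt \<theta> u)\<^sup>2 / n \<le> n / \<theta>" for u
  proof -
    have "real (deg u) * (wt \<theta> u)\<^sup>2 / n = real (deg u) * wt \<theta> u / n * wt \<theta> u"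
      by (simp add: power2_eq_square)
    also have "\<dots> \<le> 1 * (n / \<theta>)"
      using assms by (intro mult_mono deg_wt_le wt_le) auto
    finally show ?thesis by simp
  qed
  define S where "S = (\<lambda>u. \<Sum>v\<in>neighbors E u. real (deg v) * (wt \<theta> v)\<^sup>2 / n)"
  have inner: "expect arc_pmf (\<lambda>y. (pair_kernel E n \<theta> ((u, k), z) y)\<^sup>2)
     = (real (weight n \<theta> k))\<^sup>2 * S u / (n * (n * d))" for u k z
  proof -
    have "(\<Sum>v\<in>V. real (deg v) * (of_bool ({u, v} \<in> E) * real (weight n \<theta> k) * wt \<theta> v / n)\<^sup>2)
      = (\<Sum>v\<in>V. if v \<in> neighbors E u then (real (weight n \<theta> k))\<^sup>2 / n * (real (deg v) * (wt \<theta> v)\<^sup>2 / n) else 0)"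
      by (intro sum.cong refl) (auto simp: neighbors_def power2_eq_square)
    also have "\<dots> = (real (weight n \<theta> k))\<^sup>2 / n * S u"
      using neighbors_subset[of u] by (simp add: sum.If_cases Int_absorb1 S_def sum_distrib_left)
    finally show ?thesis
      using expect_arc_fst[of "\<lambda>z. (of_bool ({u, fst z} \<in> E) * real (weight n \<theta> k) * real (weight n \<theta> (snd z)) / n)\<^sup>2"]
      by (simp add: pair_kernel_def[abs_def])
  qed
  have "expect arc_pmf (\<lambda>x. expect arc_pmf (\<lambda>y. (pair_kernel E n \<theta> x y)\<^sup>2))
     = expect arc_pmf (\<lambda>x. (real (weight n \<theta> (snd (fst x))))\<^sup>2 * S (fst (fst x)) / (n * (n * d)))"
    using inner[of "fst (fst x)" "snd (fst x)" "snd x" for x] by (intro expect_cong) simp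
  also have "\<dots> = (\<Sum>u\<in>V. real (deg u) * ((wt \<theta> u)\<^sup>2 * S u / (n * (n * d)))) / (n * d)"
    by (rule expect_arc_fst[of "\<lambda>z. (real (weight n \<theta> (snd z)))\<^sup>2 * S (fst z) / (n * (n * d))", simplified fst_conv snd_conv])
  also have "\<dots> = (\<Sum>u\<in>V. \<Sum>v\<in>neighbors E u. (real (deg u) * (wt \<theta> u)\<^sup>2 / n) * (real (deg v) * (wt \<theta> v)\<^sup>2 / n)) / (n * d)\<^sup>2"
  proof -
    have "real (deg u) * ((wt \<theta> u)\<^sup>2 * S u / (n * (n * d)))
        = (\<Sum>v\<in>neighbors E u. (real (deg u) * (wt \<theta> u)\<^sup>2 / n) * (real (deg v) * (wt \<theta> v)\<^sup>2 / n)) / (n * d)" for u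
      unfolding sum_distrib_left[symmetric] S_def by simp
    then show ?thesis by (simp add: power2_eq_square flip: sum_divide_distrib)
  qed
  also have "\<dots> \<le> (\<Sum>u\<in>V. \<Sum>v\<in>neighbors E u. (n / \<theta>) * (n / \<theta>)) / (n * d)\<^sup>2"
    using assms by (intro divide_right_mono sum_mono mult_mono *) auto
  also have "\<dots> = (n * d) * (n / \<theta>)\<^sup>2 / (n * d)\<^sup>2"
    by (subst sum_arcs[symmetric]) (simp add: card_arcs split_def power2_eq_square)
  also have "\<dots> = n / (\<theta>\<^sup>2 * d)"
    using assms d_pos n_pos by (simp add: field_simps power2_eq_square)
  finally show ?thesis .
qed

lemma light_bounds: "0 \<le> light \<theta> x" "light \<theta> x \<le> 1"
  by (auto simp: light_def)

lemma heavy_bounds: "0 \<le> heavy n \<theta> x" "heavy n \<theta> x \<le> 1"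
proof -
  have "real k * real (weight n \<theta> k) / n \<le> 1" for k
    using weight_le[of k n \<theta>] by simp
  then show "0 \<le> heavy n \<theta> x" "heavy n \<theta> x \<le> 1"
    unfolding heavy_def by (auto intro!: mult_le_one simp del: times_divide_eq_left times_divide_eq_right)
qed

text \<open>An arc without light endpoint contributes at least one quarter to \<open>\<gamma>\<close>.\<close>

lemma \<gamma>_ge: "\<gamma> \<theta> \<ge> (1 - 2 * \<alpha> \<theta>) / 4"
proof -
  let ?L = "\<lambda>u. of_bool (real (deg u) \<le> \<theta>) :: real"
  have *: "?L u + 2 * (real (deg u) * wt \<theta> u / n) \<ge> 1" if "u \<in> V" for u
    using weight_ge[of \<theta> "deg u" n] deg_le[of u] deg_pos[OF that] by (auto simp: field_simps)
  \<comment> \<open>The left side is at most 0 unless both endpoints are heavy; being linear in the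
    indicators, it is easily summed over the arcs.\<close>
  have "(1 - ?L u - ?L v) / 4 \<le> heavy n \<theta> ((u, deg u), (v, deg v))" if "(u, v) \<in> arcs" for u v
  proof (cases "?L u = 0 \<and> ?L v = 0")
    case True
    have "1 / 2 * (1 / 2) \<le> (real (deg u) * wt \<theta> u / n) * (real (deg v) * wt \<theta> v / n)"
      using True *[of u] *[of v] arcs_in_V[OF that] by (intro mult_mono) auto
    then show ?thesis using True by (simp add: heavy_def)
  next
    case False
    then show ?thesis
      using heavy_bounds(1)[of \<theta> "((u, deg u), (v, deg v))"] by (auto split: if_splits)
  qed
  then have "(\<Sum>(u, v)\<in>arcs. (1 - ?L u - ?L v) / 4) / (n * d) \<le> \<gamma> \<theta>"
    unfolding \<gamma>_def expect_arc by (intro divide_right_mono sum_mono) auto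
  \<comment> \<open>Reversing arcs shows that second endpoints are light as often as first
    ones.\<close>
  moreover have "(\<Sum>(u, v)\<in>arcs. (1 - ?L u - ?L v) / 4) = (n * d - 2 * (\<Sum>(u, v)\<in>arcs. ?L u)) / 4"
    using sum_arcs_swap[of "\<lambda>u v. ?L u"]
    by (simp add: split_def sum_subtractf card_arcs flip: sum_divide_distrib)
  moreover have "\<alpha> \<theta> = (\<Sum>(u, v)\<in>arcs. ?L u) / (n * d)"
    unfolding \<alpha>_def expect_arc by (simp add: light_def)
  ultimately have "(n * d) * ((1 - 2 * \<alpha> \<theta>) / 4) \<le> (n * d) * \<gamma> \<theta>"
    by (simp add: field_simps)
  then show ?thesis
    by (rule mult_left_le_imp_le) simp
qed

end


section \<open>Estimates for one guess of the average degree\<close>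

definition weighted :: "nat \<Rightarrow> real \<Rightarrow> (('v \<times> nat) \<times> ('v \<times> nat)) list \<Rightarrow> ('v \<times> nat) list" where
  "weighted n \<theta> xs = map (\<lambda>x. (fst (fst x), weight n \<theta> (snd (fst x)))) xs"

text \<open>Hides which oracle is in use: for fixed samples the program computes the bilinear form
  exactly. The bound \<open>W\<close> on the weights limits the number of bits in
  \<open>additive_form\<close>.\<close>

definition evaluates ::
  "'v query set \<Rightarrow> 'v set \<Rightarrow> 'v set set \<Rightarrow> (('v \<times> nat) list \<Rightarrow> ('v \<times> nat) list \<Rightarrow> ('v, real) program)
    \<Rightarrow> nat \<Rightarrow> nat \<Rightarrow> nat \<Rightarrow> bool" where
  "evaluates Q V E B s W c \<longleftrightarrow> (\<forall>xs ys. length xs = s \<and> length ys = s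
     \<and> set xs \<subseteq> V \<times> {..W} \<and> set ys \<subseteq> V \<times> {..W} \<longrightarrow>
     implements Q V E (B xs ys) (return_pmf (\<Sum>x\<leftarrow>xs. \<Sum>y\<leftarrow>ys.
       of_bool ({fst x, fst y} \<in> E) * real (snd x) * real (snd y))) c)"

text \<open>The components are unbiased samples for the numerators and denominators of both ratios.
  Dividing by \<open>real n\<close> supplies the factor \<open>1 / n\<close> of
  \<open>pair_kernel\<close>, which the integer form lacks.\<close>

definition trial ::
  "(('v \<times> nat) list \<Rightarrow> ('v \<times> nat) list \<Rightarrow> ('v, real) program) \<Rightarrow> nat \<Rightarrow> real \<Rightarrow> nat
    \<Rightarrow> ('v, real \<times> real \<times> real \<times> real) program" where
  "trial B n \<theta> s = pbind sample_arc (\<lambda>a. pbind (preplicate s sample_vertex) (\<lambda>us.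
     pbind (preplicate s sample_arc) (\<lambda>xs. pbind (preplicate s sample_arc) (\<lambda>ys.
     pbind (B (weighted n \<theta> xs) (weighted n \<theta> ys)) (\<lambda>z.
     pret (light \<theta> a, heavy n \<theta> a, (\<Sum>u\<leftarrow>us. light_degree \<theta> u) / real s, z / ((real s)\<^sup>2 * real n)))))))"

text \<open>The estimate is kept as numerator and denominator, because the denominator may vanish for
  guesses that are much too small. Such guesses must be accepted, so acceptance is tested as
  \<open>g * denominator \<le> numerator\<close>.\<close>

definition estimate :: "nat \<Rightarrow> (real \<times> real \<times> real \<times> real) list \<Rightarrow> real \<times> real" where
  "estimate T zs = (if (\<Sum>z\<leftarrow>zs. fst z) / real T \<ge> 1 / 4
     then ((\<Sum>z\<leftarrow>zs. fst (snd (snd z))) / real T, (\<Sum>z\<leftarrow>zs. fst z) / real T)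
     else ((\<Sum>z\<leftarrow>zs. fst (snd z)) / real T, (\<Sum>z\<leftarrow>zs. snd (snd (snd z))) / real T))"

definition level ::
  "(('v \<times> nat) list \<Rightarrow> ('v \<times> nat) list \<Rightarrow> ('v, real) program) \<Rightarrow> nat \<Rightarrow> real \<Rightarrow> nat \<Rightarrow> nat
    \<Rightarrow> ('v, real \<times> real) program" where
  "level B n \<theta> s T = pbind (preplicate T (trial B n \<theta> s)) (\<lambda>zs. pret (estimate T zs))"

text \<open>Between \<open>d / 2\<close> and \<open>2 * d\<close> either verdict is allowed, so no
  estimate has to decide a borderline case. Accuracy is required from \<open>d / 4\<close> on,
  because the first guess not exceeding \<open>d / 2\<close> may come close to that.\<close>

definition good :: "real \<Rightarrow> real \<Rightarrow> real \<Rightarrow> real \<times> real \<Rightarrow> bool" where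
  "good d \<epsilon> g = (\<lambda>(a, b). (2 * d < g \<longrightarrow> a < g * b) \<and> (g \<le> d / 2 \<longrightarrow> g * b \<le> a)
     \<and> (d / 4 \<le> g \<and> g \<le> 2 * d \<longrightarrow> \<bar>a / b - d\<bar> \<le> \<epsilon> * d))"

section \<open>From accurate averages to a good estimate\<close>

lemma abs_divide_diff_le:
  fixes a b d r :: real
  assumes "b > 0" "\<bar>a - d * b\<bar> \<le> r * b"
  shows "\<bar>a / b - d\<bar> \<le> r"
proof -
  have "a / b - d = (a - d * b) / b"
    using assms by (simp add: diff_divide_distrib)
  then have "\<bar>a / b - d\<bar> = \<bar>a - d * b\<bar> / b"
    using assms by (simp add: abs_divide)
  also have "\<dots> \<le> r" using assms by (simp add: pos_divide_le_eq)
  finally show ?thesis .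
qed

text \<open>Here \<open>a\<close> and \<open>b\<close> estimate \<alpha> and
  \<open>\<alpha> * d\<close>. The error allowed for \<open>b\<close> grows with a guess above
  \<open>d\<close>, since sample sizes are tuned to the guess; a guess above \<open>2 * d\<close>
  only has to be rejected, which leaves room for this.\<close>

lemma good_light:
  fixes a b \<alpha> d g \<eta> :: real
  assumes a: "\<bar>a - \<alpha>\<bar> \<le> \<eta>" and b: "\<bar>b - \<alpha> * d\<bar> \<le> \<eta> * max d g" and "a \<ge> 1 / 4"
    and \<eta>: "0 < \<eta>" "\<eta> \<le> 1 / 100" and "d > 0" "g > 0"
  shows "good d (100 * \<eta>) g (b, a)"
  unfolding good_def
proof (intro case_prodI conjI impI)
  \<comment> \<open>The bound is 1/4 - 1/100.\<close>
  have \<alpha>: "\<alpha> \<ge> 6 / 25" using assms by linarith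
  show "b < g * a" if "2 * d < g"
  proof -
    have "b \<le> \<alpha> * d + \<eta> * g" using b that \<open>d > 0\<close> by (simp add: max_def split: if_splits)
    moreover have "\<alpha> * (2 * d) \<le> \<alpha> * g" using that \<alpha> by (intro mult_left_mono) auto
    moreover have "g * (\<alpha> - \<eta>) \<le> g * a" using a \<open>g > 0\<close> by (intro mult_left_mono) auto
    moreover have "g * (4 * \<eta>) < g * \<alpha>" using \<alpha> \<eta> \<open>g > 0\<close> by (intro mult_strict_left_mono) auto
    ultimately show ?thesis by (simp add: algebra_simps)
  qed
  show "g * a \<le> b" if "g \<le> d / 2"
  proof -
    have "b \<ge> \<alpha> * d - \<eta> * d" using b that \<open>d > 0\<close> by (simp add: max_def split: if_splits)
    moreover have "g * a \<le> (d / 2) * (\<alpha> + \<eta>)"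
      using a that \<open>g > 0\<close> \<open>d > 0\<close> \<open>a \<ge> 1 / 4\<close> by (intro mult_mono) auto
    moreover have "d * (3 * \<eta>) \<le> d * \<alpha>" using \<alpha> \<eta> \<open>d > 0\<close> by (intro mult_left_mono) auto
    ultimately show ?thesis by (simp add: algebra_simps)
  qed
  show "\<bar>b / a - d\<bar> \<le> 100 * \<eta> * d" if "d / 4 \<le> g \<and> g \<le> 2 * d"
  proof (rule abs_divide_diff_le)
    \<comment> \<open>This makes \<open>b - d * a\<close> at most \<open>3 * \<eta> * d\<close> in
      absolute value, while \<open>100 * \<eta> * d * a\<close> is at least
      \<open>25 * \<eta> * d\<close>.\<close>
    have "max d g \<le> 2 * d" using that \<open>d > 0\<close> by auto
    then have "\<eta> * max d g \<le> \<eta> * (2 * d)" using \<eta> by (intro mult_left_mono) auto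
    then have "\<bar>b - \<alpha> * d\<bar> \<le> 2 * \<eta> * d" using b by simp
    moreover have "\<bar>d * (a - \<alpha>)\<bar> \<le> d * \<eta>"
      using a \<open>d > 0\<close> by (simp add: abs_mult)
    moreover have "100 * \<eta> * d * (1 / 4) \<le> 100 * \<eta> * d * a"
      using \<open>a \<ge> 1 / 4\<close> \<eta> \<open>d > 0\<close> by (intro mult_left_mono) auto
    moreover have "\<eta> * d > 0" using \<eta> \<open>d > 0\<close> by simp
    moreover have "b - d * a = (b - \<alpha> * d) - d * (a - \<alpha>)" by (simp add: algebra_simps)
    ultimately show "\<bar>b - d * a\<bar> \<le> 100 * \<eta> * d * a" by (simp add: abs_le_iff algebra_simps)
  qed (use \<open>a \<ge> 1 / 4\<close> in auto)
qed

text \<open>Here \<open>h\<close> and \<open>c\<close> estimate \<gamma> and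
  \<open>\<gamma> / d\<close>. For a small guess the error \<open>\<eta> / g\<close> may exceed
  \<open>\<gamma> / d\<close>, but multiplied by \<open>g\<close> it is only \<eta>, so the guess is
  still accepted.\<close>

lemma good_heavy:
  fixes h c \<gamma> d g \<eta> :: real
  assumes h: "\<bar>h - \<gamma>\<bar> \<le> \<eta>" and c: "\<bar>c - \<gamma> / d\<bar> \<le> \<eta> / min d g" and \<gamma>: "\<gamma> \<ge> 1 / 10"
    and \<eta>: "0 < \<eta>" "\<eta> \<le> 1 / 100" and "d > 0" "g > 0"
  shows "good d (100 * \<eta>) g (h, c)"
  unfolding good_def
proof (intro case_prodI conjI impI)
  show "h < g * c" if "2 * d < g"
  proof -
    have "min d g = d" using that \<open>d > 0\<close> by simp
    then have "c \<ge> \<gamma> / d - \<eta> / d" using c by linarith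
    then have "c \<ge> (\<gamma> - \<eta>) / d" by (simp add: diff_divide_distrib)
    then have "d * c \<ge> \<gamma> - \<eta>" using \<open>d > 0\<close> by (simp add: field_simps)
    moreover from this have "0 < d * c" using \<gamma> \<eta> by linarith
    then have "c > 0" using \<open>d > 0\<close> by (simp add: zero_less_mult_iff)
    then have "2 * d * c < g * c" using that by simp
    ultimately show ?thesis using h \<gamma> \<eta> by linarith
  qed
  show "g * c \<le> h" if "g \<le> d / 2"
  proof -
    have "min d g = g" using that \<open>d > 0\<close> by simp
    then have "c \<le> \<gamma> / d + \<eta> / g" using c unfolding abs_le_iff by simp
    then have "g * c \<le> g * (\<gamma> / d + \<eta> / g)"
      using \<open>g > 0\<close> by (intro mult_left_mono) auto
    also have "\<dots> = (g / d) * \<gamma> + \<eta>" using \<open>g > 0\<close> by (simp add: algebra_simps)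
    also have "(g / d) * \<gamma> \<le> 1 / 2 * \<gamma>"
      using that \<gamma> \<open>d > 0\<close> by (intro mult_right_mono) (auto simp: field_simps)
    finally show ?thesis using h \<gamma> \<eta> by linarith
  qed
  show "\<bar>h / c - d\<bar> \<le> 100 * \<eta> * d" if "d / 4 \<le> g \<and> g \<le> 2 * d"
  proof (rule abs_divide_diff_le)
    have "\<eta> / min d g \<le> \<eta> / (d / 4)"
      using that \<eta> \<open>d > 0\<close> \<open>g > 0\<close> by (intro divide_left_mono) auto
    also have "\<eta> / (d / 4) = 4 * \<eta> / d" by simp
    finally have "\<bar>c - \<gamma> / d\<bar> \<le> 4 * \<eta> / d" using c by linarith
    then have *: "d * \<bar>c - \<gamma> / d\<bar> \<le> d * (4 * \<eta> / d)"
      using \<open>d > 0\<close> by (intro mult_left_mono) auto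
    have dc: "\<bar>d * c - \<gamma>\<bar> \<le> 4 * \<eta>"
    proof -
      have "d * c - \<gamma> = d * (c - \<gamma> / d)" using \<open>d > 0\<close> by (simp add: algebra_simps)
      then show ?thesis using * \<open>d > 0\<close> by (simp add: abs_mult)
    qed
    \<comment> \<open>The bound is 1/10 - 4/100; since 100 times 6/100 exceeds 5, it suffices for
      the final comparison.\<close>
    then have 1: "d * c \<ge> 6 / 100" using \<gamma> \<eta> by (simp add: abs_le_iff)
    then have "0 < d * c" by linarith
    then show "c > 0" using \<open>d > 0\<close> by (simp add: zero_less_mult_iff)
    have "\<bar>h - d * c\<bar> \<le> 5 * \<eta>" using h dc by (simp add: abs_le_iff)
    also have "\<dots> \<le> 100 * \<eta> * (d * c)"
      using mult_left_mono[OF 1, of "100 * \<eta>"] \<eta> by simp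
    finally show "\<bar>h - d * c\<bar> \<le> 100 * \<eta> * d * c" by simp
  qed
qed

section \<open>Cost, mean and variance of one trial\<close>

context input
begin

definition trial_pmf :: "real \<Rightarrow> nat \<Rightarrow> (real \<times> real \<times> real \<times> real) pmf" where
  "trial_pmf \<theta> s = map_pmf (\<lambda>(a, us, xs, ys). (light \<theta> a, heavy n \<theta> a,
     (\<Sum>u\<leftarrow>us. light_degree \<theta> u) / real s,
     (\<Sum>x\<leftarrow>xs. \<Sum>y\<leftarrow>ys. pair_kernel E n \<theta> x y) / (real s)\<^sup>2))
     (pair_pmf arc_pmf (pair_pmf (replicate_pmf s vertex_pmf)
       (pair_pmf (replicate_pmf s arc_pmf) (replicate_pmf s arc_pmf))))"

definition level_pmf :: "real \<Rightarrow> nat \<Rightarrow> nat \<Rightarrow> (real \<times> real) pmf" where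
  "level_pmf \<theta> s T = map_pmf (estimate T) (replicate_pmf T (trial_pmf \<theta> s))"

lemma weighted_in:
  assumes "xs \<in> set_pmf (replicate_pmf s arc_pmf)"
  shows "length (weighted n \<theta> xs) = s" "set (weighted n \<theta> xs) \<subseteq> V \<times> {..n}"
  using assms arcs_in_V
  by (fastforce simp: set_replicate_pmf weighted_def set_arc_pmf weight_def)+

lemma implements_trial:
  assumes "base_queries \<subseteq> Q" "evaluates Q V E B s n c"
  shows "implements Q V E (trial B n \<theta> s) (trial_pmf \<theta> s) (3 + (s * 2 + (s * 3 + (s * 3 + c))))"
proof -
  let ?z = "\<lambda>xs ys. \<Sum>x\<leftarrow>weighted n \<theta> xs. \<Sum>y\<leftarrow>weighted n \<theta> ys.
       of_bool ({fst x, fst y} \<in> E) * real (snd x) * real (snd y)"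
  \<comment> \<open>The integer form is \<open>n\<close> times the kernel sum, which the
    normalisation in \<open>trial\<close> cancels.\<close>
  have z: "?z xs ys = real n * (\<Sum>x\<leftarrow>xs. \<Sum>y\<leftarrow>ys. pair_kernel E n \<theta> x y)" for xs ys
    by (simp add: weighted_def o_def pair_kernel_def[abs_def] flip: sum_list_const_mult)
  have "implements Q V E (trial B n \<theta> s) (bind_pmf arc_pmf (\<lambda>a.
     bind_pmf (replicate_pmf s vertex_pmf) (\<lambda>us. bind_pmf (replicate_pmf s arc_pmf) (\<lambda>xs.
     bind_pmf (replicate_pmf s arc_pmf) (\<lambda>ys. map_pmf (\<lambda>z. (light \<theta> a, heavy n \<theta> a,
       (\<Sum>u\<leftarrow>us. light_degree \<theta> u) / real s, z / ((real s)\<^sup>2 * real n))) (return_pmf (?z xs ys)))))))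
     (3 + (s * 2 + (s * 3 + (s * 3 + c))))"
    unfolding trial_def
    by (intro implements_pbind implements_map implements_preplicate implements_sample_arc
        implements_sample_vertex assms(1) assms(2)[unfolded evaluates_def, rule_format] conjI weighted_in)
  also have "bind_pmf arc_pmf (\<lambda>a.
     bind_pmf (replicate_pmf s vertex_pmf) (\<lambda>us. bind_pmf (replicate_pmf s arc_pmf) (\<lambda>xs.
     bind_pmf (replicate_pmf s arc_pmf) (\<lambda>ys. map_pmf (\<lambda>z. (light \<theta> a, heavy n \<theta> a,
       (\<Sum>u\<leftarrow>us. light_degree \<theta> u) / real s, z / ((real s)\<^sup>2 * real n))) (return_pmf (?z xs ys))))))
     = trial_pmf \<theta> s"
    unfolding z by (simp add: trial_pmf_def pair_pmf_def map_bind_pmf bind_assoc_pmf bind_return_pmf)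
  finally show ?thesis .
qed

lemma implements_level:
  assumes "base_queries \<subseteq> Q" "evaluates Q V E B s n c"
  shows "implements Q V E (level B n \<theta> s T) (level_pmf \<theta> s T) (T * (3 + 8 * s + c))"
proof -
  have "3 + (s * 2 + (s * 3 + (s * 3 + c))) = 3 + 8 * s + c" by simp
  then show ?thesis
    unfolding level_def level_pmf_def
    using implements_map[OF implements_preplicate[OF implements_trial[OF assms]]] by metis
qed

lemma finite_trial_pmf [simp]: "finite (set_pmf (trial_pmf \<theta> s))"
  by (simp add: trial_pmf_def)

lemma expect_trial:
  "expect (trial_pmf \<theta> s) (\<lambda>z. f (fst z)) = expect arc_pmf (\<lambda>x. f (light \<theta> x))"
  "expect (trial_pmf \<theta> s) (\<lambda>z. f (fst (snd z))) = expect arc_pmf (\<lambda>x. f (heavy n \<theta> x))"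
  "expect (trial_pmf \<theta> s) (\<lambda>z. f (fst (snd (snd z)))) =
     expect (replicate_pmf s vertex_pmf) (\<lambda>us. f ((\<Sum>u\<leftarrow>us. light_degree \<theta> u) / real s))"
  "expect (trial_pmf \<theta> s) (\<lambda>z. f (snd (snd (snd z)))) =
     expect (pair_pmf (replicate_pmf s arc_pmf) (replicate_pmf s arc_pmf))
       (\<lambda>(xs, ys). f ((\<Sum>x\<leftarrow>xs. \<Sum>y\<leftarrow>ys. pair_kernel E n \<theta> x y) / (real s)\<^sup>2))"
  by (simp_all add: trial_pmf_def expect_pair split_def)

lemma square_le_one: "0 \<le> x \<Longrightarrow> x \<le> 1 \<Longrightarrow> x\<^sup>2 \<le> (1 :: real)"
  by (simp add: power_le_one)

lemma trial_light:
  "expect (trial_pmf \<theta> s) (\<lambda>z. fst z) = \<alpha> \<theta>"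
  "expect (trial_pmf \<theta> s) (\<lambda>z. (fst z - \<alpha> \<theta>)\<^sup>2) \<le> 1"
proof -
  show 1: "expect (trial_pmf \<theta> s) (\<lambda>z. fst z) = \<alpha> \<theta>"
    by (simp add: expect_trial(1)[of _ _ "\<lambda>x. x"] \<alpha>_def)
  have "expect (trial_pmf \<theta> s) (\<lambda>z. (fst z - \<alpha> \<theta>)\<^sup>2)
     \<le> expect (trial_pmf \<theta> s) (\<lambda>z. (fst z)\<^sup>2)"
    using 1 by (intro variance_le_second_moment) auto
  also have "\<dots> = expect arc_pmf (\<lambda>x. (light \<theta> x)\<^sup>2)"
    using expect_trial(1)[of \<theta> s "\<lambda>x. x\<^sup>2"] by (simp add: split_def)
  also have "\<dots> \<le> expect arc_pmf (\<lambda>_. 1)"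
    by (intro expect_mono square_le_one light_bounds) simp
  finally show "expect (trial_pmf \<theta> s) (\<lambda>z. (fst z - \<alpha> \<theta>)\<^sup>2) \<le> 1"
    by simp
qed

lemma trial_heavy:
  "expect (trial_pmf \<theta> s) (\<lambda>z. fst (snd z)) = \<gamma> \<theta>"
  "expect (trial_pmf \<theta> s) (\<lambda>z. (fst (snd z) - \<gamma> \<theta>)\<^sup>2) \<le> 1"
proof -
  show 1: "expect (trial_pmf \<theta> s) (\<lambda>z. fst (snd z)) = \<gamma> \<theta>"
    by (simp add: expect_trial(2)[of _ _ "\<lambda>x. x"] \<gamma>_def)
  have "expect (trial_pmf \<theta> s) (\<lambda>z. (fst (snd z) - \<gamma> \<theta>)\<^sup>2)
     \<le> expect (trial_pmf \<theta> s) (\<lambda>z. (fst (snd z))\<^sup>2)"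
    using 1 by (intro variance_le_second_moment) auto
  also have "\<dots> = expect arc_pmf (\<lambda>x. (heavy n \<theta> x)\<^sup>2)"
    using expect_trial(2)[of \<theta> s "\<lambda>x. x\<^sup>2"] by (simp add: split_def)
  also have "\<dots> \<le> expect arc_pmf (\<lambda>_. 1)"
    by (intro expect_mono square_le_one heavy_bounds) simp
  finally show "expect (trial_pmf \<theta> s) (\<lambda>z. (fst (snd z) - \<gamma> \<theta>)\<^sup>2) \<le> 1"
    by simp
qed

lemma trial_degree:
  assumes "s > 0" "\<theta> \<ge> 0"
  shows "expect (trial_pmf \<theta> s) (\<lambda>z. fst (snd (snd z))) = \<alpha> \<theta> * d"
    and "expect (trial_pmf \<theta> s) (\<lambda>z. (fst (snd (snd z)) - \<alpha> \<theta> * d)\<^sup>2) \<le> \<theta> * d / s"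
proof -
  let ?\<mu> = "\<alpha> \<theta> * d"
  show "expect (trial_pmf \<theta> s) (\<lambda>z. fst (snd (snd z))) = ?\<mu>"
    using assms by (simp add: expect_trial(3)[of _ _ "\<lambda>x. x"] expect_sum_list expect_light_degree)
  have "expect (trial_pmf \<theta> s) (\<lambda>z. (fst (snd (snd z)) - ?\<mu>)\<^sup>2)
     = expect (replicate_pmf s vertex_pmf) (\<lambda>us. ((\<Sum>u\<leftarrow>us. light_degree \<theta> u) / real s - ?\<mu>)\<^sup>2)"
    using expect_trial(3)[of \<theta> s "\<lambda>x. (x - ?\<mu>)\<^sup>2"] by (simp add: split_def)
  also have "(\<lambda>us. ((\<Sum>u\<leftarrow>us. light_degree \<theta> u) / real s - ?\<mu>)\<^sup>2)
     = (\<lambda>us. ((\<Sum>u\<leftarrow>us. light_degree \<theta> u) - s * ?\<mu>)\<^sup>2 / (real s)\<^sup>2)"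
    using assms by (intro ext) (simp add: field_simps flip: power_divide)
  also have "expect (replicate_pmf s vertex_pmf) \<dots>
     = s * expect vertex_pmf (\<lambda>u. (light_degree \<theta> u - ?\<mu>)\<^sup>2) / (real s)\<^sup>2"
    by (simp add: variance_sum_list expect_light_degree)
  also have "\<dots> \<le> s * (\<theta> * d) / (real s)\<^sup>2"
    using variance_le_second_moment[OF finite_pmfs(1) expect_light_degree[of \<theta>]]
      second_moment_light_degree[of \<theta>] assms
    by (intro divide_right_mono mult_left_mono) auto
  finally show "expect (trial_pmf \<theta> s) (\<lambda>z. (fst (snd (snd z)) - ?\<mu>)\<^sup>2) \<le> \<theta> * d / s"
    using assms by (simp add: power2_eq_square)
qed

text \<open>This is \<open>variance_double_sum\<close> with
  \<open>\<sigma> = n / (\<theta>\<^sup>2 * d)\<close> and \<open>b = 1 / d\<close>, divided by the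
  fourth power of \<open>s\<close>. The first term stems from single pairs, the second from
  correlations between pairs with a common arc.\<close>

lemma trial_pairs:
  assumes "s > 0" "\<theta> > 0"
  shows "expect (trial_pmf \<theta> s) (\<lambda>z. snd (snd (snd z))) = \<gamma> \<theta> / d"
    and "expect (trial_pmf \<theta> s) (\<lambda>z. (snd (snd (snd z)) - \<gamma> \<theta> / d)\<^sup>2)
       \<le> n / (\<theta>\<^sup>2 * d * (real s)\<^sup>2) + 2 / (d\<^sup>2 * s)"
proof -
  let ?\<mu> = "\<gamma> \<theta> / d" and ?R = "replicate_pmf s arc_pmf"
  let ?S = "\<lambda>xs ys. \<Sum>x\<leftarrow>xs. \<Sum>y\<leftarrow>ys. pair_kernel E n \<theta> x y"
  have "expect (pair_pmf ?R ?R) (\<lambda>(xs, ys). ?S xs ys) = expect ?R (\<lambda>xs. \<Sum>x\<leftarrow>xs. s * expect arc_pmf (pair_kernel E n \<theta> x))"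
  proof -
    have "expect ?R (?S xs) = (\<Sum>x\<leftarrow>xs. s * expect arc_pmf (pair_kernel E n \<theta> x))" for xs
      by (induction xs) (simp_all add: expect_sum_list)
    then show ?thesis by (simp add: expect_pair)
  qed
  also have "\<dots> = s * (s * ?\<mu>)"
    by (simp add: expect_sum_list expect_pair_kernel)
  finally show "expect (trial_pmf \<theta> s) (\<lambda>z. snd (snd (snd z))) = ?\<mu>"
    using assms by (simp add: expect_trial(4)[of _ _ "\<lambda>x. x"] split_def power2_eq_square)
  have "expect (trial_pmf \<theta> s) (\<lambda>z. (snd (snd (snd z)) - ?\<mu>)\<^sup>2)
     = expect (pair_pmf ?R ?R) (\<lambda>(xs, ys). (?S xs ys / (real s)\<^sup>2 - ?\<mu>)\<^sup>2)"
    using expect_trial(4)[of \<theta> s "\<lambda>x. (x - ?\<mu>)\<^sup>2"] by (simp add: split_def)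
  also have "(\<lambda>(xs, ys). (?S xs ys / (real s)\<^sup>2 - ?\<mu>)\<^sup>2)
     = (\<lambda>z. (case z of (xs, ys) \<Rightarrow> (?S xs ys - (real s)\<^sup>2 * ?\<mu>)\<^sup>2) / (real s ^ 4))"
  proof (intro ext, clarify)
    fix xs ys
    have "?S xs ys / (real s)\<^sup>2 - ?\<mu> = (?S xs ys - (real s)\<^sup>2 * ?\<mu>) / (real s)\<^sup>2"
      using assms by (simp add: diff_divide_distrib)
    then show "(?S xs ys / (real s)\<^sup>2 - ?\<mu>)\<^sup>2 = (?S xs ys - (real s)\<^sup>2 * ?\<mu>)\<^sup>2 / real s ^ 4"
      by (simp add: power_divide flip: power_mult)
  qed
  also have "expect (pair_pmf ?R ?R) \<dots>
     = expect (pair_pmf ?R ?R) (\<lambda>(xs, ys). (?S xs ys - (real s)\<^sup>2 * ?\<mu>)\<^sup>2) / real s ^ 4"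
    by simp
  also have "\<dots> \<le> ((real s)\<^sup>2 * (n / (\<theta>\<^sup>2 * d)) + 2 * real s ^ 3 * (1 / d)\<^sup>2) / real s ^ 4"
  proof (intro divide_right_mono variance_double_sum)
    show "\<bar>expect arc_pmf (\<lambda>x. pair_kernel E n \<theta> x y)\<bar> \<le> 1 / d" if "y \<in> set_pmf arc_pmf" for y
      using expect_pair_kernel_le[OF that] by (subst pair_kernel_commute)
  qed (use assms in \<open>auto simp: expect_pair_kernel expect_pair_kernel_le second_moment_pair_kernel\<close>)
  also have "\<dots> = n / (\<theta>\<^sup>2 * d * (real s)\<^sup>2) + 2 / (d\<^sup>2 * s)"
    using assms by (simp add: add_divide_distrib power2_eq_square power3_eq_cube power4_eq_xxxx)
  finally show "expect (trial_pmf \<theta> s) (\<lambda>z. (snd (snd (snd z)) - ?\<mu>)\<^sup>2)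
      \<le> n / (\<theta>\<^sup>2 * d * (real s)\<^sup>2) + 2 / (d\<^sup>2 * s)" .
qed

end


section \<open>Searching for the right guess\<close>

text \<open>The counter \<open>f\<close> bounds the number of levels, so every run is finite. The
  output 0 on exhaustion is an arbitrary default, charged to the failure probability.\<close>

primrec search ::
  "(nat \<Rightarrow> ('v, real \<times> real) program) \<Rightarrow> (nat \<Rightarrow> real) \<Rightarrow> nat \<Rightarrow> nat \<Rightarrow> 'v algorithm" where
  "search L g 0 j = Output 0"
| "search L g (Suc f) j = L j (\<lambda>ab. if g j * snd ab \<le> fst ab then Output (fst ab / snd ab)
     else search L g f (Suc j))"

text \<open>The continuation \<open>alg\<close> does not see the sample of this level, so the
  probability of rejection multiplies both its cost bound \<open>w\<close> and its failure bound
  \<open>b\<close>. \<open>S\<close> is the set of wrong outputs.\<close>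

lemma run_search_step:
  fixes P :: "('v, real \<times> real) program"
  assumes P: "implements Q V E P D c" and M': "run Q V E alg = spmf_of_pmf M'"
    and w: "(\<integral>\<^sup>+ y. ennreal (real (snd y)) \<partial>measure_pmf M') \<le> ennreal w" "w \<ge> 0"
    and b: "measure (measure_pmf M') {y. fst y \<in> S} \<le> b"
  shows "\<exists>M. run Q V E (P (\<lambda>x. if acc x then Output (out x) else alg)) = spmf_of_pmf M
    \<and> (\<integral>\<^sup>+ y. ennreal (real (snd y)) \<partial>measure_pmf M) \<le> ennreal (real c + measure (measure_pmf D) {x. \<not> acc x} * w)
    \<and> measure (measure_pmf M) {y. fst y \<in> S} \<le> measure (measure_pmf D) {x. acc x \<and> out x \<in> S}
        + measure (measure_pmf D) {x. \<not> acc x} * b"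
proof -
  obtain N where N: "map_pmf fst N = D" "\<And>x. x \<in> set_pmf N \<Longrightarrow> snd x \<le> c"
    "\<And>k. run Q V E (P k) = bind_spmf (spmf_of_pmf N)
        (\<lambda>x. map_spmf (apsnd ((+) (snd x))) (run Q V E (k (fst x))))"
    using P unfolding implements_def by blast
  define F where "F = (\<lambda>x. if acc x then return_pmf (out x, 0) else M')"
  define M where "M = bind_pmf N (\<lambda>x. map_pmf (apsnd ((+) (snd x))) (F (fst x)))"
  have "run Q V E (if acc x then Output (out x) else alg) = spmf_of_pmf (F x)" for x
    by (simp add: F_def M')
  then have run: "run Q V E (P (\<lambda>x. if acc x then Output (out x) else alg)) = spmf_of_pmf M"
    by (simp add: N(3) M_def spmf_of_pmf_bind)
  let ?R = "{x. \<not> acc x}" and ?A = "{x. acc x \<and> out x \<in> S}"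
  let ?r = "measure (measure_pmf D) ?R"
  have ind: "(\<integral>\<^sup>+ x. indicator X (fst x) \<partial>measure_pmf N) = ennreal (measure (measure_pmf D) X)" for X
  proof -
    have "(\<integral>\<^sup>+ x. indicator X (fst x) \<partial>measure_pmf N) = (\<integral>\<^sup>+ x. indicator X x \<partial>measure_pmf D)"
      by (simp add: N(1)[symmetric])
    then show ?thesis by (simp add: measure_pmf.emeasure_eq_measure)
  qed
  have "(\<integral>\<^sup>+ y. ennreal (real (snd y)) \<partial>measure_pmf M)
      = (\<integral>\<^sup>+ x. \<integral>\<^sup>+ y. ennreal (real (snd x + snd y)) \<partial>measure_pmf (F (fst x)) \<partial>measure_pmf N)"
    by (simp add: M_def)
  also have "\<dots> = (\<integral>\<^sup>+ x. ennreal (real (snd x)) + (\<integral>\<^sup>+ y. ennreal (real (snd y)) \<partial>measure_pmf (F (fst x))) \<partial>measure_pmf N)"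
    by (simp add: nn_integral_add measure_pmf.emeasure_space_1)
  also have "\<dots> \<le> (\<integral>\<^sup>+ x. ennreal (real c) + ennreal w * indicator ?R (fst x) \<partial>measure_pmf N)"
    by (intro nn_integral_mono_AE) (use N(2) w in \<open>auto simp: AE_measure_pmf_iff F_def intro!: add_mono\<close>)
  also have "\<dots> = ennreal (real c) + ennreal w * ennreal ?r"
    by (simp add: nn_integral_add nn_integral_cmult measure_pmf.emeasure_space_1 ind)
  also have "\<dots> = ennreal (real c + ?r * w)"
    using w(2) by (simp add: ennreal_plus ennreal_mult mult.commute)
  finally have cost: "(\<integral>\<^sup>+ y. ennreal (real (snd y)) \<partial>measure_pmf M) \<le> ennreal (real c + ?r * w)" .
  have b0: "b \<ge> 0" using b measure_nonneg by (rule order_trans[rotated])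
  have "emeasure (measure_pmf M) {y. fst y \<in> S}
      = (\<integral>\<^sup>+ x. emeasure (measure_pmf (F (fst x))) {y. fst y \<in> S} \<partial>measure_pmf N)"
    by (simp add: M_def vimage_def)
  also have "\<dots> \<le> (\<integral>\<^sup>+ x. indicator ?A (fst x) + ennreal b * indicator ?R (fst x) \<partial>measure_pmf N)"
  proof (intro nn_integral_mono)
    fix x
    show "emeasure (measure_pmf (F (fst x))) {y. fst y \<in> S} \<le> indicator ?A (fst x) + ennreal b * indicator ?R (fst x)"
      using b by (auto simp: F_def indicator_def measure_pmf.emeasure_eq_measure ennreal_leI)
  qed
  also have "\<dots> = ennreal (measure (measure_pmf D) ?A) + ennreal b * ennreal ?r"
    by (simp add: nn_integral_add nn_integral_cmult ind)
  also have "\<dots> = ennreal (measure (measure_pmf D) ?A + ?r * b)"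
    using b0 by (simp add: ennreal_plus ennreal_mult mult.commute)
  finally have "measure (measure_pmf M) {y. fst y \<in> S} \<le> measure (measure_pmf D) ?A + ?r * b"
    using b0 by (simp add: measure_pmf.emeasure_eq_measure del: ennreal_plus)
  with run cost show ?thesis by blast
qed

text \<open>Levels before \<open>j0\<close> are paid for in full, each at most \<open>C j0\<close>.
  From \<open>j0\<close> on, samples that are \<open>ok\<close> force acceptance, and a rejection
  probability of at most 1/4 outweighs the doubling of \<open>C\<close>.\<close>

lemma run_search:
  fixes L :: "nat \<Rightarrow> ('v, real \<times> real) program"
  assumes L: "\<And>j. j \<le> J \<Longrightarrow> implements Q V E (L j) (D j) (c j)"
    and cost: "\<And>j. j \<le> J \<Longrightarrow> real (c j) \<le> C j" "\<And>j. 0 \<le> C j" "\<And>j. C j \<le> C (Suc j)" "\<And>j. C (Suc j) \<le> 2 * C j"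
    and "j0 \<le> J"
    and bad: "\<And>j. j \<le> J \<Longrightarrow> measure (measure_pmf (D j)) {x. \<not> ok j x} \<le> \<delta>" and \<delta>: "\<delta> \<le> 1 / 4"
    and accept: "\<And>j x. j0 \<le> j \<Longrightarrow> ok j x \<Longrightarrow> g j * snd x \<le> fst x"
    and accurate: "\<And>j x. j \<le> j0 \<Longrightarrow> ok j x \<Longrightarrow> g j * snd x \<le> fst x \<Longrightarrow> fst x / snd x \<notin> S"
  shows "\<exists>M. run Q V E (search L g (Suc J) 0) = spmf_of_pmf M
    \<and> (\<integral>\<^sup>+ y. ennreal (real (snd y)) \<partial>measure_pmf M) \<le> ennreal ((real j0 + 2) * C j0)
    \<and> measure (measure_pmf M) {y. fst y \<in> S} \<le> (real j0 + 1) * \<delta>"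
proof -
  \<comment> \<open>From \<open>j0\<close> on, \<open>2 * C j\<close> solves the cost recursion:
    \<open>C j + 1/4 * (2 * C (Suc j)) \<le> 2 * C j\<close>.\<close>
  define W where "W j = (if j0 \<le> j then 2 * C j else (real j0 - real j + 2) * C j0)" for j
  \<comment> \<open>Passing \<open>j0\<close> counts as failure, hence the bound 1; every level up
    to \<open>j0\<close> adds \<delta>.\<close>
  define B where "B j = (if j0 < j then 1 else (real j0 - real j + 1) * \<delta>)" for j
  have W0: "W j \<ge> 0" for j using cost(2) by (simp add: W_def)
  have mono: "C i \<le> C j" if "i \<le> j" for i j
    using cost(3) that by (rule lift_Suc_mono_le)
  have "\<exists>M. run Q V E (search L g f j) = spmf_of_pmf M
    \<and> (\<integral>\<^sup>+ y. ennreal (real (snd y)) \<partial>measure_pmf M) \<le> ennreal (W j)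
    \<and> measure (measure_pmf M) {y. fst y \<in> S} \<le> B j" if "f + j = Suc J" for f j
    using that
  proof (induction f arbitrary: j)
    case 0
    then show ?case using \<open>j0 \<le> J\<close>
      by (intro exI[of _ "return_pmf (0, 0)"]) (auto simp: B_def)
  next
    case (Suc f)
    then obtain M' where M': "run Q V E (search L g f (Suc j)) = spmf_of_pmf M'"
      "(\<integral>\<^sup>+ y. ennreal (real (snd y)) \<partial>measure_pmf M') \<le> ennreal (W (Suc j))"
      "measure (measure_pmf M') {y. fst y \<in> S} \<le> B (Suc j)"
      by (metis add_Suc_right add_Suc_shift)
    have j: "j \<le> J" using Suc.prems by simp
    let ?acc = "\<lambda>x. g j * snd x \<le> fst x"
    let ?A = "measure (measure_pmf (D j)) {x. ?acc x \<and> fst x / snd x \<in> S}"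
    let ?r = "measure (measure_pmf (D j)) {x. \<not> ?acc x}"
    obtain M where M: "run Q V E (search L g (Suc f) j) = spmf_of_pmf M"
      "(\<integral>\<^sup>+ y. ennreal (real (snd y)) \<partial>measure_pmf M) \<le> ennreal (real (c j) + ?r * W (Suc j))"
      "measure (measure_pmf M) {y. fst y \<in> S} \<le> ?A + ?r * B (Suc j)"
      using run_search_step[OF L[OF j] M'(1,2) W0 M'(3), of ?acc "\<lambda>x. fst x / snd x"]
      unfolding search.simps by blast
    have r1: "?r \<le> 1" "?r \<ge> 0" by auto
    have r4: "?r \<le> 1 / 4" if "j0 \<le> j"
    proof -
      have "?r \<le> measure (measure_pmf (D j)) {x. \<not> ok j x}"
        using accept[OF that] by (intro measure_pmf.finite_measure_mono) auto
      then show ?thesis using bad[OF j] \<delta> by linarith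
    qed
    have A: "?A \<le> \<delta>" if "j \<le> j0"
    proof -
      have "?A \<le> measure (measure_pmf (D j)) {x. \<not> ok j x}"
        using accurate[OF that] by (intro measure_pmf.finite_measure_mono) auto
      then show ?thesis using bad[OF j] by linarith
    qed
    have "real (c j) + ?r * W (Suc j) \<le> W j"
    proof (cases "j0 \<le> j")
      case True
      have "?r * W (Suc j) \<le> 1 / 4 * W (Suc j)"
        using r4[OF True] W0 by (rule mult_right_mono)
      then show ?thesis
        using True cost(1)[OF j] cost(4)[of j] by (simp add: W_def)
    next
      case False
      \<comment> \<open>For \<open>Suc j = j0\<close> both branches of \<open>W\<close> give
        \<open>2 * C j0\<close>.\<close>
      have "W (Suc j) = (real j0 - real j + 1) * C j0"
        using False by (auto simp: W_def not_le of_nat_diff dest!: Suc_leI le_antisym)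
      moreover have "?r * W (Suc j) \<le> 1 * W (Suc j)"
        using r1(1) W0 by (rule mult_right_mono)
      moreover have "C j \<le> C j0" using False by (intro mono) simp
      ultimately show ?thesis
        using False cost(1)[OF j] by (simp add: W_def algebra_simps)
    qed
    moreover have "measure (measure_pmf M) {y. fst y \<in> S} \<le> B j"
    proof (cases j j0 rule: linorder_cases)
      case less
      have "B (Suc j) = (real j0 - real j) * \<delta>" using less by (simp add: B_def)
      moreover have "?r * B (Suc j) \<le> 1 * B (Suc j)"
        using r1(1) M'(3) measure_nonneg by (intro mult_right_mono) (auto intro: order_trans[rotated])
      ultimately show ?thesis using less A M(3) by (simp add: B_def algebra_simps)
    next
      case equal
      \<comment> \<open>Wrong acceptance and rejection at \<open>j0\<close> are disjoint and both
        contradict \<open>ok\<close>, so together they account for \<delta> only once.\<close>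
      have "?A + ?r = measure (measure_pmf (D j)) ({x. ?acc x \<and> fst x / snd x \<in> S} \<union> {x. \<not> ?acc x})"
        by (intro measure_pmf.finite_measure_Union[symmetric]) auto
      also have "\<dots> \<le> measure (measure_pmf (D j)) {x. \<not> ok j x}"
        using accurate[of j] accept[of j] equal by (intro measure_pmf.finite_measure_mono) auto
      finally show ?thesis using equal M(3) bad[OF j] by (simp add: B_def)
    next
      case greater
      then show ?thesis by (simp add: B_def)
    qed
    ultimately show ?case using M by (meson ennreal_leI order_trans)
  qed
  from this[of "Suc J" 0] obtain M where "run Q V E (search L g (Suc J) 0) = spmf_of_pmf M"
    "(\<integral>\<^sup>+ y. ennreal (real (snd y)) \<partial>measure_pmf M) \<le> ennreal (W 0)"
    "measure (measure_pmf M) {y. fst y \<in> S} \<le> B 0"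
    by auto
  then show ?thesis by (intro exI[of _ M]) (auto simp: W_def B_def split: if_splits)
qed

section \<open>Failure probability of a single level\<close>

context input
begin

text \<open>A union bound over four Chebyshev estimates: \<open>T1\<close> serves
  \<open>light\<close>, \<open>heavy\<close> and the correlation term of the pairs,
  \<open>T2\<close> the light degrees and \<open>T3\<close> the main term of the pairs. The constant
  is 3 * 10000 + 30000.\<close>

lemma level_not_good:
  fixes \<epsilon> K g \<theta> :: real and s T :: nat
  assumes \<epsilon>: "0 < \<epsilon>" "\<epsilon> < 1" and pos: "K > 0" "g > 0" "\<theta> > 0" "s > 0" "T > 0"
    and T1: "K \<le> T * \<epsilon>\<^sup>2"
    and T2: "\<theta> * K \<le> g * s * T * \<epsilon>\<^sup>2"
    and T3: "n * g * K \<le> \<theta>\<^sup>2 * (real s)\<^sup>2 * T * \<epsilon>\<^sup>2"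
  shows "measure (measure_pmf (level_pmf \<theta> s T)) {x. \<not> good d \<epsilon> g x} \<le> 60000 / K"
proof -
  \<comment> \<open>\<open>good_light\<close> and \<open>good_heavy\<close> lose a factor 100, whose
    square is the 10000 below.\<close>
  define \<eta> where "\<eta> = \<epsilon> / 100"
  have \<eta>: "0 < \<eta>" "\<eta> \<le> 1 / 100" "\<epsilon> = 100 * \<eta>" using \<epsilon> by (auto simp: \<eta>_def)
  let ?R = "replicate_pmf T (trial_pmf \<theta> s)"
  let ?B = "\<lambda>f \<mu> t. {zs. \<bar>(\<Sum>z\<leftarrow>zs. f z) / real T - \<mu>\<bar> > t}"
  let ?B1 = "?B (\<lambda>z. fst z) (\<alpha> \<theta>) \<eta>" and ?B2 = "?B (\<lambda>z. fst (snd z)) (\<gamma> \<theta>) \<eta>"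
  let ?B3 = "?B (\<lambda>z. fst (snd (snd z))) (\<alpha> \<theta> * d) (\<eta> * max d g)"
  let ?B4 = "?B (\<lambda>z. snd (snd (snd z))) (\<gamma> \<theta> / d) (\<eta> / min d g)"
  let ?M = "measure (measure_pmf ?R)"
  have u: "1 / (T * \<eta>\<^sup>2) \<le> 10000 / K"
    using T1 pos \<eta> by (simp add: field_simps)
  have B1: "?M ?B1 \<le> 10000 / K"
    using chebyshev_average[OF finite_trial_pmf trial_light \<eta>(1) pos(5)] u by (rule order_trans)
  have B2: "?M ?B2 \<le> 10000 / K"
    using chebyshev_average[OF finite_trial_pmf trial_heavy \<eta>(1) pos(5)] u by (rule order_trans)
  have B3: "?M ?B3 \<le> 10000 / K"
  proof -
    have "?M ?B3 \<le> \<theta> * d / s / (T * (\<eta> * max d g)\<^sup>2)"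
      using pos \<eta> by (intro chebyshev_average finite_trial_pmf trial_degree) auto
    also have "\<dots> \<le> \<theta> * d / s / (T * (\<eta>\<^sup>2 * (d * g)))"
    proof (rule divide_left_mono)
      \<comment> \<open>Replacing the maximum by the geometric mean cancels the unknown
        \<open>d\<close> against the variance.\<close>
      have "d * g \<le> (max d g)\<^sup>2"
        using pos unfolding power2_eq_square by (intro mult_mono) auto
      then show "T * (\<eta>\<^sup>2 * (d * g)) \<le> T * (\<eta> * max d g)\<^sup>2"
        by (simp add: power_mult_distrib mult_left_mono)
    qed (use pos \<eta> in auto)
    also have "\<dots> = \<theta> / (g * s * T * \<eta>\<^sup>2)"
      by simp
    also have "\<dots> \<le> 10000 / K"
      using T2 pos \<eta> by (simp add: field_simps)
    finally show ?thesis .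
  qed
  have B4: "?M ?B4 \<le> 30000 / K"
  proof -
    \<comment> \<open>Each variance term uses the bound on \<open>(min d g)\<^sup>2\<close> that
      cancels its power of \<open>d\<close>.\<close>
    have m: "min d g > 0" "(min d g)\<^sup>2 \<le> d * g" "(min d g)\<^sup>2 \<le> d\<^sup>2"
      using pos unfolding power2_eq_square by (auto intro!: mult_mono)
    have "?M ?B4 \<le> (n / (\<theta>\<^sup>2 * d * (real s)\<^sup>2) + 2 / (d\<^sup>2 * s)) / (T * (\<eta> / min d g)\<^sup>2)"
      using pos \<eta> m by (intro chebyshev_average finite_trial_pmf trial_pairs) auto
    also have "\<dots> = n / (\<theta>\<^sup>2 * d * (real s)\<^sup>2) * (min d g)\<^sup>2 / (T * \<eta>\<^sup>2) + 2 / (d\<^sup>2 * s) * (min d g)\<^sup>2 / (T * \<eta>\<^sup>2)"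
      by (simp add: power_divide add_divide_distrib distrib_right)
    also have "\<dots> \<le> n / (\<theta>\<^sup>2 * d * (real s)\<^sup>2) * (d * g) / (T * \<eta>\<^sup>2) + 2 / (d\<^sup>2 * s) * d\<^sup>2 / (T * \<eta>\<^sup>2)"
      using m pos by (intro add_mono divide_right_mono mult_left_mono) auto
    also have "\<dots> = n * g / (\<theta>\<^sup>2 * (real s)\<^sup>2 * T * \<eta>\<^sup>2) + 2 / s * (1 / (T * \<eta>\<^sup>2))"
      by simp
    also have "n * g / (\<theta>\<^sup>2 * (real s)\<^sup>2 * T * \<eta>\<^sup>2) \<le> 10000 / K"
      using T3 pos \<eta> by (simp add: field_simps)
    also have "2 / s * (1 / (T * \<eta>\<^sup>2)) \<le> 2 * (10000 / K)"
      using u pos by (intro mult_mono) (auto simp: field_simps)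
    finally show ?thesis by simp
  qed
  have sub: "{zs. \<not> good d \<epsilon> g (estimate T zs)} \<subseteq> ?B1 \<union> ?B2 \<union> (?B3 \<union> ?B4)"
  proof (rule subsetI, rule ccontr)
    fix zs
    assume bad: "zs \<in> {zs. \<not> good d \<epsilon> g (estimate T zs)}" and "zs \<notin> ?B1 \<union> ?B2 \<union> (?B3 \<union> ?B4)"
    then have B: "zs \<notin> ?B1" "zs \<notin> ?B2" "zs \<notin> ?B3" "zs \<notin> ?B4" by blast+
    note B = B[unfolded mem_Collect_eq not_less]
    have "good d \<epsilon> g (estimate T zs)"
    proof (cases "(\<Sum>z\<leftarrow>zs. fst z) / real T \<ge> 1 / 4")
      case True
      then show ?thesis
        using good_light[OF B(1) B(3) True \<eta>(1,2) d_pos pos(2)] by (simp add: estimate_def \<eta>(3))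
    next
      case False
      \<comment> \<open>13/50 is 1/4 + 1/100, and \<open>\<gamma>_ge\<close> then gives 3/25, more
        than the 1/10 required by \<open>good_heavy\<close>.\<close>
      then have "\<alpha> \<theta> \<le> 13 / 50" using B(1) \<eta> by linarith
      then have "\<gamma> \<theta> \<ge> 1 / 10" using \<gamma>_ge[of \<theta>] by (simp add: field_simps)
      then show ?thesis
        using False good_heavy[OF B(2) B(4) _ \<eta>(1,2) d_pos pos(2)] by (simp add: estimate_def \<eta>(3))
    qed
    then show False using bad by simp
  qed
  have "measure (measure_pmf (level_pmf \<theta> s T)) {x. \<not> good d \<epsilon> g x}
      = ?M {zs. \<not> good d \<epsilon> g (estimate T zs)}"
    by (simp add: level_pmf_def vimage_def)
  also have "\<dots> \<le> ?M (?B1 \<union> ?B2 \<union> (?B3 \<union> ?B4))"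
    using sub by (rule measure_pmf.finite_measure_mono) simp
  also have "\<dots> \<le> ?M (?B1 \<union> ?B2) + ?M (?B3 \<union> ?B4)"
    by (rule measure_Un_le) auto
  also have "\<dots> \<le> (?M ?B1 + ?M ?B2) + (?M ?B3 + ?M ?B4)"
    by (intro add_mono measure_Un_le) auto
  also have "\<dots> \<le> 60000 / K"
    using B1 B2 B3 B4 by simp
  finally show ?thesis .
qed

end


section \<open>Evaluating the pair statistic by queries\<close>

definition pair_form :: "('v \<times> nat) list \<Rightarrow> ('v \<times> nat) list \<Rightarrow> ('v, real) program" where
  "pair_form xs ys = lincomb (concat (map (\<lambda>x. map (\<lambda>y.
     (PairQuery (fst x) (fst y), real (snd x) * real (snd y))) ys) xs))"

definition total_weight :: "('v \<times> nat) list \<Rightarrow> 'v \<Rightarrow> nat" where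
  "total_weight xs v = (\<Sum>x\<leftarrow>xs. if fst x = v then snd x else 0)"

text \<open>Splitting by the bits of the total weight turns a weighted sum over a sample with repetitions
  into logarithmically many unweighted sums over sets.\<close>

definition layer :: "('v \<times> nat) list \<Rightarrow> nat \<Rightarrow> 'v set" where
  "layer xs i = {v \<in> fst ` set xs. bit (total_weight xs v) i}"

text \<open>The signs are those of the inclusion-exclusion in \<open>sum_adj_cross\<close>;
  \<open>c\<close> carries the weight of a pair of bits.\<close>

definition cross_queries :: "'v set \<Rightarrow> 'v set \<Rightarrow> real \<Rightarrow> ('v query \<times> real) list" where
  "cross_queries A B c = [(Additive (A \<union> B), c), (Additive (A \<inter> B), c),
     (Additive (A - B), - c), (Additive (B - A), - c)]"

text \<open>When two binary expansions are multiplied, bit \<open>i\<close> of one and bit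
  \<open>j\<close> of the other contribute \<open>2 ^ (i + j)\<close> times an unweighted count
  between two layers.\<close>

definition additive_form ::
  "nat \<Rightarrow> ('v \<times> nat) list \<Rightarrow> ('v \<times> nat) list \<Rightarrow> ('v, real) program" where
  "additive_form m xs ys = lincomb (concat (map (\<lambda>(i, j).
     cross_queries (layer xs i) (layer ys j) (2 ^ (i + j))) (List.product [0..<m] [0..<m])))"

lemma sum_list_concat_map: "(\<Sum>x\<leftarrow>concat (map f xs). g x) = (\<Sum>x\<leftarrow>xs. \<Sum>y\<leftarrow>f x. g y)"
  by (induction xs) auto

lemma total_weight_le:
  assumes "\<And>x. x \<in> set xs \<Longrightarrow> snd x \<le> W"
  shows "total_weight xs v \<le> length xs * W"
  using assms
proof (induction xs)
  case (Cons x xs)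
  then have "total_weight xs v \<le> length xs * W" "snd x \<le> W" by auto
  then show ?case by (auto simp: total_weight_def)
qed (simp add: total_weight_def)

lemma sum_total_weight:
  fixes F :: "'v \<Rightarrow> real"
  assumes "finite V" "fst ` set xs \<subseteq> V"
  shows "(\<Sum>x\<leftarrow>xs. real (snd x) * F (fst x)) = (\<Sum>v\<in>V. real (total_weight xs v) * F v)"
  using assms(2)
proof (induction xs)
  case (Cons x xs)
  have "(\<Sum>v\<in>V. real (total_weight (x # xs) v) * F v)
    = (\<Sum>v\<in>V. (if fst x = v then real (snd x) * F (fst x) else 0) + real (total_weight xs v) * F v)"
    by (intro sum.cong refl) (auto simp: total_weight_def algebra_simps)
  then show ?case
    using Cons assms(1) by (simp add: sum.distrib)
qed (simp add: total_weight_def)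

lemma sum_bits:
  assumes "k < 2 ^ m"
  shows "(\<Sum>i<m. 2 ^ i * of_bool (bit k i)) = real k"
proof -
  have "k = take_bit m k" using assms by (simp add: take_bit_nat_eq_self)
  also have "\<dots> = (\<Sum>i<m. push_bit i (of_bool (bit k i)))"
    by (simp add: take_bit_sum lessThan_atLeast0)
  finally have "real k = real (\<Sum>i<m. push_bit i (of_bool (bit k i)))" by metis
  then show ?thesis by (simp add: push_bit_eq_mult mult.commute)
qed

lemma total_weight_layers:
  assumes "total_weight xs v < 2 ^ m"
  shows "(\<Sum>i<m. 2 ^ i * of_bool (v \<in> layer xs i)) = real (total_weight xs v)"
proof -
  \<comment> \<open>Vertices outside the sample have total weight 0, so excluding them from
    \<open>layer\<close>, which keeps its cardinality small, loses nothing.\<close>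
  have "total_weight xs v = 0" if "v \<notin> fst ` set xs"
    using that by (induction xs) (auto simp: total_weight_def)
  then have "v \<in> layer xs i \<longleftrightarrow> bit (total_weight xs v) i" for i
    by (cases "v \<in> fst ` set xs") (simp_all add: layer_def)
  then show ?thesis using sum_bits[OF assms] by simp
qed

lemma card_layer_le: "finite (layer xs i)" "card (layer xs i) \<le> length xs"
proof -
  have "layer xs i \<subseteq> set (map fst xs)" by (auto simp: layer_def)
  then show "finite (layer xs i)" by (rule finite_subset) simp
  have "card (layer xs i) \<le> card (set (map fst xs))"
    using \<open>layer xs i \<subseteq> _\<close> by (intro card_mono) auto
  also have "\<dots> \<le> length xs" using card_length[of "map fst xs"] by simp
  finally show "card (layer xs i) \<le> length xs" .
qed

section \<open>Adjacency counts from either oracle\<close>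

context input
begin

definition adj :: "'v \<Rightarrow> 'v \<Rightarrow> real" where "adj u v = of_bool ({u, v} \<in> E)"

definition inside :: "'v set \<Rightarrow> nat" where "inside S = card {e \<in> E. e \<subseteq> S}"

lemma adj_commute: "adj u v = adj v u"
  by (simp add: adj_def insert_commute)

lemma sum_adj_eq_inside:
  assumes "finite S"
  shows "(\<Sum>u\<in>S. \<Sum>v\<in>S. adj u v) = 2 * real (inside S)"
proof -
  have "(\<Sum>u\<in>S. \<Sum>v\<in>S. adj u v) = (\<Sum>(u, v)\<in>S \<times> S. of_bool ((u, v) \<in> arcs))"
    by (simp add: sum.cartesian_product adj_def arcs_def)
  also have "\<dots> = real (card (S \<times> S \<inter> arcs))"
    using assms by (simp add: split_def)
  also have "S \<times> S \<inter> arcs = {(u, v). {u, v} \<in> {e \<in> E. e \<subseteq> S}}"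
    by (auto simp: arcs_def)
  also have "card \<dots> = 2 * inside S"
    unfolding inside_def by (rule card_orientations) auto
  finally show ?thesis by simp
qed

text \<open>Inclusion-exclusion recovers the number of adjacent pairs of two overlapping sets from
  numbers of induced edges.\<close>

lemma sum_adj_cross:
  assumes "finite A" "finite B"
  shows "(\<Sum>u\<in>A. \<Sum>v\<in>B. adj u v)
    = real (inside (A \<union> B)) + real (inside (A \<inter> B)) - real (inside (A - B)) - real (inside (B - A))"
proof -
  define e where "e = (\<lambda>X Y. \<Sum>u\<in>X. \<Sum>v\<in>Y. adj u v)"
  define P I R where "P = A - B" and "I = A \<inter> B" and "R = B - A"
  have fin: "finite P" "finite I" "finite R" using assms by (auto simp: P_def I_def R_def)
  have disj: "P \<inter> I = {}" "I \<inter> R = {}" "P \<inter> R = {}" "(P \<union> I) \<inter> R = {}"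
    by (auto simp: P_def I_def R_def)
  have "A \<union> R = A \<union> B" by (auto simp: R_def)
  have AB: "A = P \<union> I" "B = I \<union> R"
    by (auto simp: P_def I_def R_def)
  have eL: "e (X \<union> Y) Z = e X Z + e Y Z" if "finite X" "finite Y" "X \<inter> Y = {}" for X Y Z
    using that by (simp add: e_def sum.union_disjoint)
  have eR: "e Z (X \<union> Y) = e Z X + e Z Y" if "finite X" "finite Y" "X \<inter> Y = {}" for X Y Z
    using that by (simp add: e_def sum.union_disjoint sum.distrib)
  have comm: "e X Y = e Y X" for X Y
    unfolding e_def by (subst sum.swap) (simp add: adj_commute)
  have in_eq: "e X X = 2 * real (inside X)" if "finite X" for X
    using sum_adj_eq_inside[OF that] by (simp add: e_def)
  \<comment> \<open>By additivity and symmetry both sides expand to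
    \<open>2 * (e P I + e P R + e I I + e I R)\<close>.\<close>
  have "2 * e (P \<union> I) (I \<union> R) = e (P \<union> I \<union> R) (P \<union> I \<union> R) + e I I - e P P - e R R"
    using fin disj comm[of I P] comm[of R P] comm[of R I] by (simp add: eL eR)
  then have "2 * e A B = e (A \<union> B) (A \<union> B) + e I I - e P P - e R R"
    by (simp only: AB(1,2)[symmetric] \<open>A \<union> R = A \<union> B\<close>)
  then have "2 * e A B = 2 * real (inside (A \<union> B)) + 2 * real (inside I) - 2 * real (inside P) - 2 * real (inside R)"
    using fin assms by (simp add: in_eq)
  then show ?thesis by (simp add: e_def P_def I_def R_def)
qed

lemma evaluates_pair_form:
  assumes "pair_queries \<subseteq> Q"
  shows "evaluates Q V E pair_form s W (s * s)"
  unfolding evaluates_def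
proof (intro allI impI, elim conjE)
  fix xs ys :: "('v \<times> nat) list"
  assume len: "length xs = s" "length ys = s" and sub: "set xs \<subseteq> V \<times> {..W}" "set ys \<subseteq> V \<times> {..W}"
  let ?qs = "concat (map (\<lambda>x. map (\<lambda>y. (PairQuery (fst x) (fst y), real (snd x) * real (snd y))) ys) xs)"
  let ?ans = "\<lambda>q :: 'v query. (case q of PairQuery u v \<Rightarrow> Truth ({u, v} \<in> E)) :: 'v answer"
  have impl: "implements Q V E (pair_form xs ys)
    (return_pmf (\<Sum>(q, c)\<leftarrow>?qs. c * real (number (?ans q)))) (\<Sum>(q, c)\<leftarrow>?qs. cost q)"
    unfolding pair_form_def
  proof (rule implements_lincomb)
    fix q c assume "(q, c) \<in> set ?qs"
    then obtain x y where "x \<in> set xs" "y \<in> set ys" "q = PairQuery (fst x) (fst y)" by auto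
    moreover from this have "fst x \<in> V" "fst y \<in> V" using sub by auto
    ultimately show "q \<in> Q \<and> respond V E q = return_spmf (?ans q)"
      using assms by (auto simp: pair_queries_def)
  qed
  have cost: "(\<Sum>(q, c)\<leftarrow>?qs. cost q) = s * s"
    by (simp add: sum_list_concat_map o_def sum_list_triv len)
  have eq: "(\<Sum>(q, c)\<leftarrow>?qs. c * real (number (?ans q)))
     = (\<Sum>x\<leftarrow>xs. \<Sum>y\<leftarrow>ys. of_bool ({fst x, fst y} \<in> E) * real (snd x) * real (snd y))"
    by (simp add: sum_list_concat_map o_def mult_ac)
  show "implements Q V E (pair_form xs ys) (return_pmf (\<Sum>x\<leftarrow>xs. \<Sum>y\<leftarrow>ys.
       of_bool ({fst x, fst y} \<in> E) * real (snd x) * real (snd y))) (s * s)"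
    using impl unfolding cost eq .
qed

text \<open>A total weight is at most \<open>s * W\<close>, so \<open>m\<close> bits represent it,
  and each of the \<open>m * m\<close> pairs of layers costs at most \<open>4 * s\<close>.\<close>

lemma evaluates_additive_form:
  assumes "additive_queries \<subseteq> Q" "s * W < 2 ^ m"
  shows "evaluates Q V E (additive_form m) s W (m * m * (4 * s))"
  unfolding evaluates_def
proof (intro allI impI, elim conjE)
  fix xs ys :: "('v \<times> nat) list"
  assume len: "length xs = s" "length ys = s" and sub: "set xs \<subseteq> V \<times> {..W}" "set ys \<subseteq> V \<times> {..W}"
  let ?qs = "concat (map (\<lambda>(i, j). cross_queries (layer xs i) (layer ys j) (2 ^ (i + j)))
     (List.product [0..<m] [0..<m]))"
  let ?ans = "\<lambda>q :: 'v query. (case q of Additive S \<Rightarrow> Number (inside S)) :: 'v answer"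
  have layers: "layer xs i \<subseteq> V" "layer ys i \<subseteq> V" for i
    using sub by (auto simp: layer_def)
  have lt: "total_weight xs v < 2 ^ m" "total_weight ys v < 2 ^ m" for v
    using total_weight_le[of xs W v] total_weight_le[of ys W v] sub len assms(2) by fastforce+
  have impl: "implements Q V E (additive_form m xs ys)
    (return_pmf (\<Sum>(q, c)\<leftarrow>?qs. c * real (number (?ans q)))) (\<Sum>(q, c)\<leftarrow>?qs. cost q)"
    unfolding additive_form_def
  proof (rule implements_lincomb)
    fix q c assume "(q, c) \<in> set ?qs"
    then obtain i j where "(q, c) \<in> set (cross_queries (layer xs i) (layer ys j) (2 ^ (i + j)))" by auto
    then have "\<exists>S\<subseteq>V. q = Additive S"
      using layers(1)[of i] layers(2)[of j] by (auto simp: cross_queries_def)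
    then show "q \<in> Q \<and> respond V E q = return_spmf (?ans q)"
      using assms(1) by (auto simp: additive_queries_def inside_def)
  qed
  have le: "(\<Sum>(q, c)\<leftarrow>?qs. cost q) \<le> m * m * (4 * s)"
  proof -
    have "(\<Sum>(q, c)\<leftarrow>?qs. cost q) = (\<Sum>(i, j)\<leftarrow>List.product [0..<m] [0..<m].
       \<Sum>(q, c)\<leftarrow>cross_queries (layer xs i) (layer ys j) (2 ^ (i + j)). cost q)"
      by (simp add: sum_list_concat_map split_def)
    also have "\<dots> \<le> (\<Sum>(i, j)\<leftarrow>List.product [0..<m] [0..<m]. 4 * s)"
    proof (intro sum_list_mono, clarify)
      fix i j
      let ?A = "layer xs i" and ?B = "layer ys j"
      note fin = card_layer_le(1)[of xs i] card_layer_le(1)[of ys j]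
      \<comment> \<open>Union and intersection together cost as much as both layers, and the two
        differences at most as much again.\<close>
      have "card (?A \<union> ?B) + card (?A \<inter> ?B) = card ?A + card ?B"
        using card_Un_Int[OF fin] by simp
      moreover have "card (?A - ?B) \<le> card ?A" "card (?B - ?A) \<le> card ?B"
        using fin by (auto intro: card_mono)
      ultimately show "(\<Sum>(q, c)\<leftarrow>cross_queries ?A ?B (2 ^ (i + j)). cost q) \<le> 4 * s"
        using card_layer_le(2)[of xs i] card_layer_le(2)[of ys j] len by (simp add: cross_queries_def)
    qed
    also have "\<dots> = m * m * (4 * s)" by (simp add: split_def sum_list_triv)
    finally show ?thesis .
  qed
  have eq: "(\<Sum>(q, c)\<leftarrow>?qs. c * real (number (?ans q)))
     = (\<Sum>x\<leftarrow>xs. \<Sum>y\<leftarrow>ys. of_bool ({fst x, fst y} \<in> E) * real (snd x) * real (snd y))"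
  proof -
    let ?x = "\<lambda>i u. of_bool (u \<in> layer xs i) :: real" and ?y = "\<lambda>j v. of_bool (v \<in> layer ys j) :: real"
    have ind: "(\<Sum>u\<in>V. of_bool (u \<in> L) * F u) = sum F L" if "L \<subseteq> V" for L and F :: "'v \<Rightarrow> real"
      using that by (simp add: Int_absorb1)
    have cross: "(\<Sum>(q, c)\<leftarrow>cross_queries (layer xs i) (layer ys j) r. c * real (number (?ans q)))
       = r * (\<Sum>u\<in>V. \<Sum>v\<in>V. ?x i u * (?y j v * adj u v))" for i j r
    proof -
      have "(\<Sum>u\<in>V. \<Sum>v\<in>V. ?x i u * (?y j v * adj u v)) = (\<Sum>u\<in>layer xs i. \<Sum>v\<in>layer ys j. adj u v)"
        by (simp only: sum_distrib_left[symmetric] ind layers)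
      then show ?thesis
        by (simp add: sum_adj_cross card_layer_le(1)) (simp add: cross_queries_def algebra_simps)
    qed
    have "(\<Sum>(q, c)\<leftarrow>?qs. c * real (number (?ans q)))
      = (\<Sum>(i, j)\<leftarrow>List.product [0..<m] [0..<m]. 2 ^ (i + j) * (\<Sum>u\<in>V. \<Sum>v\<in>V. ?x i u * (?y j v * adj u v)))"
      by (simp add: sum_list_concat_map split_def cross[unfolded split_def])
    also have "\<dots> = (\<Sum>i<m. \<Sum>j<m. 2 ^ (i + j) * (\<Sum>u\<in>V. \<Sum>v\<in>V. ?x i u * (?y j v * adj u v)))"
      by (simp add: sum_list_distinct_conv_sum_set distinct_product sum.cartesian_product lessThan_atLeast0)
    also have "\<dots> = (\<Sum>i<m. \<Sum>u\<in>V. (2 ^ i * ?x i u) * (\<Sum>j<m. \<Sum>v\<in>V. (2 ^ j * ?y j v) * adj u v))"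
    proof (intro sum.cong refl)
      fix i
      have "(\<Sum>j<m. 2 ^ (i + j) * (\<Sum>u\<in>V. \<Sum>v\<in>V. ?x i u * (?y j v * adj u v)))
        = (\<Sum>j<m. \<Sum>u\<in>V. (2 ^ i * ?x i u) * (\<Sum>v\<in>V. (2 ^ j * ?y j v) * adj u v))"
        by (simp add: sum_distrib_left power_add mult_ac)
      also have "\<dots> = (\<Sum>u\<in>V. \<Sum>j<m. (2 ^ i * ?x i u) * (\<Sum>v\<in>V. (2 ^ j * ?y j v) * adj u v))"
        by (rule sum.swap)
      finally show "(\<Sum>j<m. 2 ^ (i + j) * (\<Sum>u\<in>V. \<Sum>v\<in>V. ?x i u * (?y j v * adj u v)))
        = (\<Sum>u\<in>V. (2 ^ i * ?x i u) * (\<Sum>j<m. \<Sum>v\<in>V. (2 ^ j * ?y j v) * adj u v))"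
        by (simp only: sum_distrib_left)
    qed
    \<comment> \<open>With the sums over bits innermost, each recombines to a total weight.\<close>
    also have "\<dots> = (\<Sum>u\<in>V. (\<Sum>i<m. 2 ^ i * ?x i u) * (\<Sum>v\<in>V. (\<Sum>j<m. 2 ^ j * ?y j v) * adj u v))"
      by (subst sum.swap, subst (2) sum.swap) (simp only: sum_distrib_right)
    also have "\<dots> = (\<Sum>u\<in>V. real (total_weight xs u) * (\<Sum>v\<in>V. real (total_weight ys v) * adj u v))"
      by (simp only: total_weight_layers[OF lt(1)] total_weight_layers[OF lt(2)])
    also have "\<dots> = (\<Sum>x\<leftarrow>xs. real (snd x) * (\<Sum>y\<leftarrow>ys. real (snd y) * adj (fst x) (fst y)))"
    proof -
      have "fst ` set xs \<subseteq> V" "fst ` set ys \<subseteq> V" using sub by auto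
      then show ?thesis by (simp only: finite_V sum_total_weight[symmetric])
    qed
    also have "\<dots> = (\<Sum>x\<leftarrow>xs. \<Sum>y\<leftarrow>ys. of_bool ({fst x, fst y} \<in> E) * real (snd x) * real (snd y))"
      by (simp add: adj_def mult_ac flip: sum_list_const_mult)
    finally show ?thesis .
  qed
  show "implements Q V E (additive_form m xs ys) (return_pmf (\<Sum>x\<leftarrow>xs. \<Sum>y\<leftarrow>ys.
       of_bool ({fst x, fst y} \<in> E) * real (snd x) * real (snd y))) (m * m * (4 * s))"
    using implements_mono[OF impl le] unfolding eq .
qed

end


section \<open>Choice of parameters\<close>

text \<open>The additional level brings the last guess \<open>n / 2 ^ depth n\<close> down to at
  most 1/2, hence to at most \<open>d / 2\<close>, since \<open>d \<ge> 1\<close>.\<close>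

definition depth :: "nat \<Rightarrow> nat" where
  "depth n = Suc (nat \<lceil>log 2 (real n)\<rceil>)"

lemma depth_ge: "n > 0 \<Longrightarrow> 2 * real n \<le> 2 ^ depth n"
proof -
  assume n: "n > 0"
  have "log 2 (real n) \<le> real (nat \<lceil>log 2 (real n)\<rceil>)" by linarith
  then have "real n \<le> 2 powr real (nat \<lceil>log 2 (real n)\<rceil>)"
    using n by (simp add: le_powr_iff log_le_iff)
  then show ?thesis by (simp add: depth_def powr_realpow)
qed

text \<open>Since \<open>ln 2 \<ge> 2 / 3\<close>, the binary logarithm is at most
  \<open>3 / 2 * ln n\<close>, and for \<open>n \<ge> 2\<close> additive constants are absorbed by
  multiples of \<open>ln n\<close>.\<close>

lemma depth_le: "n \<ge> 2 \<Longrightarrow> real (depth n) + 2 \<le> 8 * ln (real n)"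
proof -
  assume n: "n \<ge> 2"
  have ln2: "ln 2 \<ge> (2 / 3 :: real)" by (rule ln2_ge_two_thirds)
  have l: "ln 2 \<le> ln (real n)" using n by simp
  have "log 2 (real n) \<ge> 0" using n by (simp add: zero_le_log_cancel_iff)
  \<comment> \<open>The 4 is the 2 of the claim, the \<open>Suc\<close> in \<open>depth\<close> and
    1 for rounding up.\<close>
  then have "real (depth n) + 2 \<le> log 2 (real n) + 4" unfolding depth_def by linarith
  also have "log 2 (real n) \<le> 3 / 2 * ln (real n)"
  proof -
    have "ln (real n) \<ge> 0" using n by simp
    then have "ln (real n) / ln 2 \<le> ln (real n) / (2 / 3)"
      using ln2 by (intro divide_left_mono) auto
    then show ?thesis by (simp add: log_def)
  qed
  also have "4 \<le> 6 * ln (real n)" using ln2 l by simp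
  finally show ?thesis using l ln2 by linarith
qed

text \<open>The guess for the average degree at depth \<open>j\<close> is \<open>n / 2 ^ j\<close>, and the threshold between
  light and heavy vertices exceeds it by the factor \<open>r = (2 ^ j) powr q\<close>.\<close>

definition estimator ::
  "(nat \<Rightarrow> ('v \<times> nat) list \<Rightarrow> ('v \<times> nat) list \<Rightarrow> ('v, real) program) \<Rightarrow> real
    \<Rightarrow> (nat \<Rightarrow> nat) \<Rightarrow> (nat \<Rightarrow> nat) \<Rightarrow> nat \<Rightarrow> 'v algorithm" where
  "estimator B q s T n = search
     (\<lambda>j. level (B j) n ((2 ^ j) powr q * (real n / 2 ^ j)) (s j) (T j)) (\<lambda>j. real n / 2 ^ j)
     (Suc (depth n)) 0"

section \<open>The search with given sample sizes\<close>

context input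
begin

text \<open>\<open>T2\<close> and \<open>T3\<close> are the conditions of
  \<open>level_not_good\<close> with the guess cancelled. \<open>K\<close> grows with the number of
  levels so that the failures of all of them sum to at most 1/4.\<close>

lemma run_estimator:
  fixes s T c :: "nat \<Rightarrow> nat" and K q \<epsilon> \<kappa> :: real
  assumes Q: "base_queries \<subseteq> Q" and \<epsilon>: "0 < \<epsilon>" "\<epsilon> < 1" and q: "0 < q" "q \<le> 1"
    and B: "\<And>j. j \<le> depth n \<Longrightarrow> evaluates Q V E (B j) (s j) n (c j)"
    and K: "K = 240000 * (real (depth n) + 1)"
    and s: "\<And>j. s j > 0" and T: "\<And>j. T j > 0"
    and T1: "\<And>j. K \<le> T j * \<epsilon>\<^sup>2"
    and T2: "\<And>j. (2 ^ j) powr q * K \<le> s j * T j * \<epsilon>\<^sup>2"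
    and T3: "\<And>j. 2 ^ j * K \<le> ((2 ^ j) powr q)\<^sup>2 * (real (s j))\<^sup>2 * T j * \<epsilon>\<^sup>2"
    and cost: "\<And>j. j \<le> depth n \<Longrightarrow> real (T j * (3 + 8 * s j + c j)) \<le> \<kappa> * (2 ^ j) powr q"
    and \<kappa>: "\<kappa> \<ge> 0"
  shows "\<exists>M. run Q V E (estimator B q s T n) = spmf_of_pmf M
    \<and> (\<integral>\<^sup>+ y. ennreal (real (snd y)) \<partial>measure_pmf M)
        \<le> ennreal ((real (depth n) + 2) * \<kappa> * (4 * (n / d) powr q))
    \<and> measure (measure_pmf M) {y. fst y \<in> - {(1 - \<epsilon>) * d .. (1 + \<epsilon>) * d}} \<le> 1 / 4"
proof -
  let ?J = "depth n" and ?g = "\<lambda>j. real n / 2 ^ j" and ?r = "\<lambda>j. (2 ^ j) powr q :: real"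
  let ?\<theta> = "\<lambda>j. ?r j * ?g j"
  let ?S = "- {(1 - \<epsilon>) * d .. (1 + \<epsilon>) * d}"
  \<comment> \<open>The first guess not exceeding \<open>d / 2\<close>; as guesses are halved and
    start above \<open>d / 4\<close>, it still lies above \<open>d / 4\<close>.\<close>
  define j0 where "j0 = (LEAST j. ?g j \<le> d / 2)"
  have J: "?g ?J \<le> d / 2"
  proof -
    have "2 * real n * 1 \<le> 2 ^ ?J * d"
      using depth_ge[of n] d_ge_1 by (intro mult_mono) auto
    then show ?thesis by (simp add: field_simps)
  qed
  have j0: "?g j0 \<le> d / 2" "j0 \<le> ?J"
    unfolding j0_def using J by (auto intro: LeastI Least_le)
  have g0: "d / 4 < ?g j0"
  proof (cases j0)
    case 0
    have "d / 4 < real n" using d_le_n d_pos by linarith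
    then show ?thesis using 0 by simp
  next
    case (Suc i)
    then have "d / 2 < ?g i" unfolding j0_def using not_less_Least by (metis lessI not_le)
    then have "d / 2 / 2 < ?g i / 2" by (rule divide_strict_right_mono) simp
    then show ?thesis using Suc by (simp add: mult.commute)
  qed
  have g_mono: "?g j \<le> ?g i" if "i \<le> j" for i j
    using that by (intro divide_left_mono power_increasing) auto
  have rpos: "?r j > 0" for j by simp
  have Kpos: "K > 0" using K by simp
  define \<delta> where "\<delta> = 60000 / K"
  have \<delta>: "(real ?J + 1) * \<delta> = 1 / 4" "\<delta> \<le> 1 / 4" "\<delta> \<ge> 0"
    by (auto simp: \<delta>_def K field_simps)
  have rSuc: "?r (Suc j) = 2 powr q * ?r j" for j
    by (simp add: powr_mult)
  \<comment> \<open>The cost bound grows by \<open>2 powr q\<close> per level, so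
    \<open>q \<le> 1\<close> keeps the growth within the factor 2 of
    \<open>run_search\<close>.\<close>
  have two: "1 \<le> 2 powr q" "2 powr q \<le> 2"
    using q powr_mono[of q 1 2] by (auto intro: ge_one_powr_ge_zero)
  have "\<exists>M. run Q V E (search (\<lambda>j. level (B j) n (?\<theta> j) (s j) (T j)) ?g (Suc ?J) 0) = spmf_of_pmf M
    \<and> (\<integral>\<^sup>+ y. ennreal (real (snd y)) \<partial>measure_pmf M) \<le> ennreal ((real j0 + 2) * (\<kappa> * ?r j0))
    \<and> measure (measure_pmf M) {y. fst y \<in> ?S} \<le> (real j0 + 1) * \<delta>"
  proof (rule run_search[where ok = "\<lambda>j. good d \<epsilon> (?g j)"])
    fix j
    show "implements Q V E (level (B j) n (?\<theta> j) (s j) (T j)) (level_pmf (?\<theta> j) (s j) (T j))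
        (T j * (3 + 8 * s j + c j))" if "j \<le> ?J"
      using that by (intro implements_level Q B)
    show "real (T j * (3 + 8 * s j + c j)) \<le> \<kappa> * ?r j" if "j \<le> ?J"
      using that by (rule cost)
    show "0 \<le> \<kappa> * ?r j" using \<kappa> by simp
    show "\<kappa> * ?r j \<le> \<kappa> * ?r (Suc j)"
      using two(1) rpos[of j] unfolding rSuc by (intro mult_left_mono \<kappa>) simp
    show "\<kappa> * ?r (Suc j) \<le> 2 * (\<kappa> * ?r j)"
    proof -
      have "\<kappa> * ?r j * 2 powr q \<le> \<kappa> * ?r j * 2"
        using two(2) \<kappa> by (intro mult_left_mono) auto
      then show ?thesis unfolding rSuc by (simp add: mult_ac)
    qed
    show "measure (measure_pmf (level_pmf (?\<theta> j) (s j) (T j))) {x. \<not> good d \<epsilon> (?g j) x} \<le> \<delta>"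
      unfolding \<delta>_def
    proof (rule level_not_good)
      show "?\<theta> j * K \<le> ?g j * s j * T j * \<epsilon>\<^sup>2"
        using mult_left_mono[OF T2[of j], of "?g j"] by (simp add: mult_ac)
      show "n * ?g j * K \<le> (?\<theta> j)\<^sup>2 * (real (s j))\<^sup>2 * T j * \<epsilon>\<^sup>2"
        using mult_left_mono[OF T3[of j], of "(?g j)\<^sup>2"] by (simp add: power2_eq_square mult_ac)
    qed (use \<epsilon> Kpos s T T1 in auto)
    fix x
    show "?g j * snd x \<le> fst x" if "j0 \<le> j" "good d \<epsilon> (?g j) x"
      using that(2) order_trans[OF g_mono[OF that(1)] j0(1)] unfolding good_def split_def by blast
    show "fst x / snd x \<notin> ?S" if "j \<le> j0" "good d \<epsilon> (?g j) x" "?g j * snd x \<le> fst x"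
    proof -
      \<comment> \<open>The bound \<open>?g j \<le> 2 * d\<close> follows from acceptance, since a
        good sample rejects larger guesses.\<close>
      have "d / 4 \<le> ?g j" using g_mono[OF that(1)] g0 by linarith
      then have "\<bar>fst x / snd x - d\<bar> \<le> \<epsilon> * d"
        using that(2,3) unfolding good_def split_def by (metis less_le_not_le linorder_not_less)
      then show ?thesis by (auto simp: abs_le_iff algebra_simps)
    qed
  qed (use j0 \<delta> in auto)
  then obtain M where M: "run Q V E (estimator B q s T n) = spmf_of_pmf M"
    "(\<integral>\<^sup>+ y. ennreal (real (snd y)) \<partial>measure_pmf M) \<le> ennreal ((real j0 + 2) * (\<kappa> * ?r j0))"
    "measure (measure_pmf M) {y. fst y \<in> ?S} \<le> (real j0 + 1) * \<delta>"
    unfolding estimator_def by blast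
  \<comment> \<open>\<open>2 ^ j0\<close> is \<open>n\<close> divided by the guess, which exceeds
    \<open>d / 4\<close>.\<close>
  have "?r j0 \<le> (4 * (n / d)) powr q"
    using g0 q by (intro powr_mono2) (auto simp: field_simps)
  also have "\<dots> = 4 powr q * (n / d) powr q"
    by (rule powr_mult)
  also have "\<dots> \<le> 4 * (n / d) powr q"
    using q powr_mono[of q 1 4] by (intro mult_right_mono) auto
  finally have r: "?r j0 \<le> 4 * (n / d) powr q" .
  have "(real j0 + 2) * (\<kappa> * ?r j0) \<le> (real ?J + 2) * (\<kappa> * (4 * (n / d) powr q))"
    using j0(2) \<kappa> r by (intro mult_mono mult_left_mono) auto
  moreover have "(real j0 + 1) * \<delta> \<le> (real ?J + 1) * \<delta>"
    using j0(2) \<delta>(3) by (intro mult_right_mono) auto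
  ultimately show ?thesis
    using M \<delta>(1) by (intro exI[of _ M]) (auto simp: mult.assoc intro: order_trans ennreal_leI)
qed

text \<open>A vertex and its neighbour are distinct. This lets \<open>depth_le\<close> absorb
  constants into \<open>ln n\<close>.\<close>

lemma n_ge_2: "n \<ge> 2"
proof -
  obtain v where "v \<in> V" using V_nonempty by blast
  then obtain w where w: "w \<in> V" "{v, w} \<in> E"
    using neighbors_nonempty[of v] neighbors_subset[of v] by (auto simp: neighbors_def)
  then have "card {v, w} \<le> card V" using \<open>v \<in> V\<close> by (intro card_mono) auto
  then show ?thesis using card_edge[OF w(2)] by (simp add: n_def)
qed

end

text \<open>Reduces either oracle to a choice of \<open>B\<close>, \<open>s\<close> and
  \<open>T\<close>. In the final constant, 4 comes from replacing the guess by \<open>d\<close> and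
  8 from \<open>depth_le\<close>.\<close>

lemma approximates_estimator:
  fixes Q :: "'v query set" and s T :: "nat \<Rightarrow> real \<Rightarrow> nat \<Rightarrow> nat" and c :: "nat \<Rightarrow> nat \<Rightarrow> nat" and \<kappa> :: "nat \<Rightarrow> real \<Rightarrow> real"
  assumes Q: "base_queries \<subseteq> Q" and q: "0 < q" "q \<le> 1"
    and B: "\<And>V E (\<epsilon> :: real) j. input_graph V E \<Longrightarrow> j \<le> depth (card V) \<Longrightarrow>
        evaluates Q V E (B (card V) j) (s (card V) \<epsilon> j) (card V) (c (card V) j)"
    and s: "\<And>n (\<epsilon> :: real) j. s n \<epsilon> j > 0"
    and T: "\<And>n (\<epsilon> :: real) j. 0 < \<epsilon> \<Longrightarrow> \<epsilon> < 1 \<Longrightarrow> T n \<epsilon> j > 0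
        \<and> 240000 * (real (depth n) + 1) \<le> T n \<epsilon> j * \<epsilon>\<^sup>2
        \<and> (2 ^ j) powr q * (240000 * (real (depth n) + 1)) \<le> s n \<epsilon> j * T n \<epsilon> j * \<epsilon>\<^sup>2
        \<and> 2 ^ j * (240000 * (real (depth n) + 1)) \<le> ((2 ^ j) powr q)\<^sup>2 * (real (s n \<epsilon> j))\<^sup>2 * T n \<epsilon> j * \<epsilon>\<^sup>2"
    and cost: "\<And>n (\<epsilon> :: real) j. n \<ge> 2 \<Longrightarrow> 0 < \<epsilon> \<Longrightarrow> \<epsilon> < 1 \<Longrightarrow> j \<le> depth n \<Longrightarrow>
        real (T n \<epsilon> j * (3 + 8 * s n \<epsilon> j + c n j)) \<le> C * (1 / \<epsilon>\<^sup>2) * (real (depth n) + 2) ^ 3 * (2 ^ j) powr q"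
    and C: "C \<ge> 0"
  shows "approximates_average_degree Q (\<lambda>n \<epsilon>. estimator (B n) q (s n \<epsilon>) (T n \<epsilon>) n) (3 / 4)
     (\<lambda>n d \<epsilon>. (4 * 8 ^ 5 * C) * (1 / \<epsilon> ^ 2) * ln n ^ 5 * (n / d) powr q)"
  unfolding approximates_average_degree_def
proof (intro allI impI, elim conjE)
  fix V :: "'v set" and E and \<epsilon> :: real
  assume graph: "input_graph V E" and \<epsilon>: "0 < \<epsilon>" "\<epsilon> < 1"
  interpret input V E by standard (rule graph)
  define \<kappa> where "\<kappa> = C * (1 / \<epsilon>\<^sup>2) * (real (depth n) + 2) ^ 3"
  have \<kappa>: "\<kappa> \<ge> 0" using C by (simp add: \<kappa>_def)
  have "\<exists>M. run Q V E (estimator (B n) q (s n \<epsilon>) (T n \<epsilon>) n) = spmf_of_pmf M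
    \<and> (\<integral>\<^sup>+ y. ennreal (real (snd y)) \<partial>measure_pmf M)
        \<le> ennreal ((real (depth n) + 2) * \<kappa> * (4 * (n / d) powr q))
    \<and> measure (measure_pmf M) {y. fst y \<in> - {(1 - \<epsilon>) * d .. (1 + \<epsilon>) * d}} \<le> 1 / 4"
  proof (rule run_estimator[where c = "c n"])
    show "evaluates Q V E (B n j) (s n \<epsilon> j) n (c n j)" if "j \<le> depth n" for j
      using B[OF graph] that by (simp add: n_def)
    show "real (T n \<epsilon> j * (3 + 8 * s n \<epsilon> j + c n j)) \<le> \<kappa> * (2 ^ j) powr q" if "j \<le> depth n" for j
      unfolding \<kappa>_def using n_ge_2 \<epsilon> that by (rule cost)
  qed (use Q \<epsilon> q s T[OF \<epsilon>] \<kappa> in auto)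
  then obtain M where M: "run Q V E (estimator (B n) q (s n \<epsilon>) (T n \<epsilon>) n) = spmf_of_pmf M"
    "(\<integral>\<^sup>+ y. ennreal (real (snd y)) \<partial>measure_pmf M)
        \<le> ennreal ((real (depth n) + 2) * \<kappa> * (4 * (n / d) powr q))"
    "measure (measure_pmf M) {y. fst y \<in> - {(1 - \<epsilon>) * d .. (1 + \<epsilon>) * d}} \<le> 1 / 4"
    by blast
  let ?I = "{(1 - \<epsilon>) * d .. (1 + \<epsilon>) * d}"
  have "measure (measure_pmf M) {y. fst y \<in> ?I} = 1 - measure (measure_pmf M) {y. fst y \<in> - ?I}"
    using measure_pmf.prob_compl[of "{y. fst y \<in> - ?I}" M] by (simp add: Compl_eq_Diff_UNIV[symmetric] Collect_neg_eq[symmetric])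
  then have p: "measure (measure_pmf M) {y. fst y \<in> ?I} \<ge> 3 / 4"
    using M(3) by linarith
  let ?L = "real (depth n) + 2"
  have "?L * \<kappa> * (4 * (n / d) powr q) = (4 * C) * (1 / \<epsilon>\<^sup>2) * ?L ^ 4 * (n / d) powr q"
    by (simp add: \<kappa>_def power_numeral_reduce mult_ac)
  also have "\<dots> \<le> (4 * C) * (1 / \<epsilon>\<^sup>2) * (8 * ln n) ^ 5 * (n / d) powr q"
  proof -
    \<comment> \<open>Three factors come from the cost of a level and one from the number of levels;
      the power is then raised to that of the claimed bound.\<close>
    have "?L ^ 4 \<le> ?L ^ 5" by (rule power_increasing) auto
    also have "\<dots> \<le> (8 * ln n) ^ 5"
      using depth_le[OF n_ge_2] by (rule power_mono) simp
    finally show ?thesis using C by (intro mult_right_mono mult_left_mono) auto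
  qed
  also have "\<dots> = (4 * 8 ^ 5 * C) * (1 / \<epsilon> ^ 2) * ln n ^ 5 * (n / d) powr q"
    by (simp add: power_mult_distrib mult_ac)
  finally have "ennreal (?L * \<kappa> * (4 * (n / d) powr q))
      \<le> ennreal ((4 * 8 ^ 5 * C) * (1 / \<epsilon> ^ 2) * ln n ^ 5 * (n / d) powr q)"
    by (rule ennreal_leI)
  then show "let alg = estimator (B (card V)) q (s (card V) \<epsilon>) (T (card V) \<epsilon>) (card V); d = average_degree V E in
           lossless_spmf (run Q V E alg)
         \<and> prob_output Q V E alg {(1 - \<epsilon>) * d .. (1 + \<epsilon>) * d} \<ge> 3 / 4
         \<and> expected_cost Q V E alg \<le> ennreal ((4 * 8 ^ 5 * C) * (1 / \<epsilon> ^ 2) * ln (real (card V)) ^ 5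
             * (real (card V) / d) powr q)"
    using M(1,2) p unfolding Let_def prob_output_def expected_cost_def n_def[symmetric] d_def[symmetric]
    by (auto intro: order_trans)
qed

section \<open>Sample sizes for the two oracles\<close>

lemma nat_ceiling_bounds:
  fixes x :: real
  assumes "x \<ge> 1"
  shows "x \<le> real (nat \<lceil>x\<rceil>)" "real (nat \<lceil>x\<rceil>) \<le> 2 * x" "nat \<lceil>x\<rceil> > 0"
  using assms by linarith+

lemma powr_inverse_power:
  "k > 0 \<Longrightarrow> ((2 ^ j) powr (1 / real k)) ^ k = (2 :: real) ^ j"
  by (simp add: powr_power)

lemma one_le_powr: "q \<ge> 0 \<Longrightarrow> 1 \<le> (2 ^ j :: real) powr q"
  by (intro ge_one_powr_ge_zero) auto

text \<open>With one pair per trial and threshold factor \<open>r\<close>, the light degrees ask for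
  about \<open>r\<close> trials and the pairs for about \<open>2 ^ j / r\<^sup>2\<close>; these
  agree when \<open>r\<close> is the cube root of \<open>2 ^ j\<close>.\<close>

lemma approximates_pair:
  "\<exists>(A :: nat \<Rightarrow> real \<Rightarrow> 'v algorithm) p C. p > 1 / 2 \<and>
     approximates_average_degree pair_queries A p
       (\<lambda>n d \<epsilon>. C * (1 / \<epsilon> ^ 2) * ln n ^ 5 * (n / d) powr (1 / 3))"
proof -
  let ?r = "\<lambda>j. (2 ^ j) powr (1 / 3) :: real" and ?K = "\<lambda>n. 240000 * (real (depth n) + 1)"
  define T where "T = (\<lambda>n (\<epsilon> :: real) j. nat \<lceil>?K n * ?r j / \<epsilon>\<^sup>2\<rceil>)"
  define s where "s = (\<lambda>(n :: nat) (\<epsilon> :: real) (j :: nat). 1 :: nat)"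
  have r1: "1 \<le> ?r j" for j by (rule one_le_powr) simp
  have T: "?K n * ?r j / \<epsilon>\<^sup>2 \<le> real (T n \<epsilon> j)" "real (T n \<epsilon> j) \<le> 2 * (?K n * ?r j / \<epsilon>\<^sup>2)" "T n \<epsilon> j > 0"
    if \<epsilon>: "0 < \<epsilon>" "\<epsilon> < 1" for n j and \<epsilon> :: real
  proof -
    have "1 * 1 \<le> ?K n * ?r j" using r1[of j] by (intro mult_mono) auto
    moreover have "\<epsilon>\<^sup>2 \<le> 1" using \<epsilon> by (simp add: power_le_one)
    ultimately have "1 \<le> ?K n * ?r j / \<epsilon>\<^sup>2" using \<epsilon> by (simp add: pos_le_divide_eq)
    from nat_ceiling_bounds[OF this] show "?K n * ?r j / \<epsilon>\<^sup>2 \<le> real (T n \<epsilon> j)"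
      "real (T n \<epsilon> j) \<le> 2 * (?K n * ?r j / \<epsilon>\<^sup>2)" "T n \<epsilon> j > 0"
      unfolding T_def by auto
  qed
  have T': "?K n * ?r j \<le> T n \<epsilon> j * \<epsilon>\<^sup>2" if "0 < \<epsilon>" "\<epsilon> < 1" for n j and \<epsilon> :: real
    using T(1)[OF that, of n j] that by (simp add: pos_divide_le_eq)
  have "approximates_average_degree pair_queries
     (\<lambda>n \<epsilon>. estimator ((\<lambda>n j. pair_form) n) (1 / 3) (s n \<epsilon>) (T n \<epsilon>) n :: 'v algorithm) (3 / 4)
     (\<lambda>n d \<epsilon>. (4 * 8 ^ 5 * 5760000) * (1 / \<epsilon> ^ 2) * ln n ^ 5 * (n / d) powr (1 / 3))"
  proof (rule approximates_estimator[where c = "\<lambda>n j. 1"])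
    show "base_queries \<subseteq> pair_queries" by (auto simp: pair_queries_def)
    show "evaluates pair_queries V E pair_form (s (card V) \<epsilon> j) (card V) 1"
      if "input_graph V E" for V :: "'v set" and E \<epsilon> j
      using input.evaluates_pair_form[of V E pair_queries 1 "card V"] that by (simp add: input_def s_def)
    fix n :: nat and \<epsilon> :: real and j :: nat
    assume \<epsilon>: "0 < \<epsilon>" "\<epsilon> < 1"
    note T' = T'[OF \<epsilon>, of n j]
    have "?K n * 1 \<le> ?K n * ?r j" using r1[of j] by (intro mult_left_mono) auto
    then have "?K n \<le> T n \<epsilon> j * \<epsilon>\<^sup>2" using T' by linarith
    moreover have "2 ^ j * ?K n = (?r j)\<^sup>2 * (?K n * ?r j)"
      using powr_inverse_power[of 3 j] by (simp add: power2_eq_square power3_eq_cube)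
    then have "2 ^ j * ?K n \<le> (?r j)\<^sup>2 * (T n \<epsilon> j * \<epsilon>\<^sup>2)"
      using mult_left_mono[OF T' zero_le_power2] by (simp only:)
    ultimately show "T n \<epsilon> j > 0 \<and> ?K n \<le> T n \<epsilon> j * \<epsilon>\<^sup>2 \<and> ?r j * ?K n \<le> s n \<epsilon> j * T n \<epsilon> j * \<epsilon>\<^sup>2
        \<and> 2 ^ j * ?K n \<le> (?r j)\<^sup>2 * (real (s n \<epsilon> j))\<^sup>2 * T n \<epsilon> j * \<epsilon>\<^sup>2"
      using T(3)[OF \<epsilon>] T' by (simp add: s_def mult_ac)
    show "real (T n \<epsilon> j * (3 + 8 * s n \<epsilon> j + 1)) \<le> 5760000 * (1 / \<epsilon>\<^sup>2) * (real (depth n) + 2) ^ 3 * ?r j"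
    proof -
      have "real (depth n) + 1 \<le> (real (depth n) + 2) ^ 3"
        using power_increasing[of 1 3 "real (depth n) + 2"] by simp
      then have "(real (depth n) + 1) * (?r j / \<epsilon>\<^sup>2) \<le> (real (depth n) + 2) ^ 3 * (?r j / \<epsilon>\<^sup>2)"
        by (rule mult_right_mono) simp
      moreover have "real (T n \<epsilon> j) \<le> 480000 * ((real (depth n) + 1) * (?r j / \<epsilon>\<^sup>2))"
        using T(2)[OF \<epsilon>, of n j] by (simp add: algebra_simps add_divide_distrib)
      \<comment> \<open>A trial costs 3 + 8 + 1 = 12, and 12 * 480000 is 5760000.\<close>
      ultimately have "real (T n \<epsilon> j) * 12 \<le> 5760000 * ((real (depth n) + 2) ^ 3 * (?r j / \<epsilon>\<^sup>2))"
        by linarith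
      then show ?thesis by (simp add: s_def)
    qed
  qed (auto simp: s_def)
  then show ?thesis by (intro exI[of _ "3 / 4"] exI conjI) auto
qed

text \<open>Samples of size about \<open>r\<close> form about \<open>r\<^sup>2\<close> pairs per
  trial, so the pair condition becomes \<open>2 ^ j \<le> r ^ 4\<close> and the number of trials
  need not grow with \<open>j\<close>.\<close>

lemma approximates_additive:
  "\<exists>(A :: nat \<Rightarrow> real \<Rightarrow> 'v algorithm) p C. p > 1 / 2 \<and>
     approximates_average_degree additive_queries A p
       (\<lambda>n d \<epsilon>. C * (1 / \<epsilon> ^ 2) * ln n ^ 5 * (n / d) powr (1 / 4))"
proof -
  let ?r = "\<lambda>j. (2 ^ j) powr (1 / 4) :: real" and ?K = "\<lambda>n. 240000 * (real (depth n) + 1)"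
  define T where "T = (\<lambda>n (\<epsilon> :: real) (j :: nat). nat \<lceil>?K n / \<epsilon>\<^sup>2\<rceil>)"
  define s where "s = (\<lambda>(n :: nat) (\<epsilon> :: real) (j :: nat). nat \<lceil>?r j\<rceil>)"
  \<comment> \<open>Sample size and weights are at most \<open>2 ^ depth n\<close>, so their product
    is at most \<open>2 ^ (2 * depth n)\<close>; one more bit makes the inequality strict.\<close>
  define m where "m = (\<lambda>n. 2 * depth n + 1)"
  have r1: "1 \<le> ?r j" for j by (rule one_le_powr) simp
  have s: "?r j \<le> real (s n \<epsilon> j)" "real (s n \<epsilon> j) \<le> 2 * ?r j" "s n \<epsilon> j > 0" for n \<epsilon> j
    using nat_ceiling_bounds[OF r1] unfolding s_def by auto
  have T: "?K n / \<epsilon>\<^sup>2 \<le> real (T n \<epsilon> j)" "real (T n \<epsilon> j) \<le> 2 * (?K n / \<epsilon>\<^sup>2)" "T n \<epsilon> j > 0"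
    if \<epsilon>: "0 < \<epsilon>" "\<epsilon> < 1" for n j and \<epsilon> :: real
  proof -
    have "\<epsilon>\<^sup>2 \<le> 1" using \<epsilon> by (simp add: power_le_one)
    moreover have "1 \<le> ?K n" by simp
    ultimately have "\<epsilon>\<^sup>2 \<le> ?K n" by linarith
    then have "1 \<le> ?K n / \<epsilon>\<^sup>2" using \<epsilon> by (simp add: pos_le_divide_eq)
    from nat_ceiling_bounds[OF this] show "?K n / \<epsilon>\<^sup>2 \<le> real (T n \<epsilon> j)"
      "real (T n \<epsilon> j) \<le> 2 * (?K n / \<epsilon>\<^sup>2)" "T n \<epsilon> j > 0"
      unfolding T_def by auto
  qed
  have T': "?K n \<le> T n \<epsilon> j * \<epsilon>\<^sup>2" if "0 < \<epsilon>" "\<epsilon> < 1" for n j and \<epsilon> :: real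
    using T(1)[OF that, of n j] that by (simp add: pos_divide_le_eq)
  have "approximates_average_degree additive_queries
     (\<lambda>n \<epsilon>. estimator ((\<lambda>n j. additive_form (m n)) n) (1 / 4) (s n \<epsilon>) (T n \<epsilon>) n :: 'v algorithm) (3 / 4)
     (\<lambda>n d \<epsilon>. (4 * 8 ^ 5 * 57600000) * (1 / \<epsilon> ^ 2) * ln n ^ 5 * (n / d) powr (1 / 4))"
  \<comment> \<open>\<open>c\<close> takes no accuracy as argument, so the sample size is spelled
    out in it.\<close>
  proof (rule approximates_estimator[where c = "\<lambda>n j. m n * m n * (4 * nat \<lceil>?r j\<rceil>)"])
    show "base_queries \<subseteq> additive_queries" by (auto simp: additive_queries_def)
    show "evaluates additive_queries V E (additive_form (m (card V))) (s (card V) \<epsilon> j) (card V)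
        (m (card V) * m (card V) * (4 * nat \<lceil>?r j\<rceil>))"
      if graph: "input_graph V E" and j: "j \<le> depth (card V)" for V :: "'v set" and E \<epsilon> j
    proof -
      interpret input V E by standard (rule graph)
      let ?J = "depth (card V)"
      have "?r j \<le> (2 ^ j) powr 1" by (intro powr_mono) auto
      then have "\<lceil>?r j\<rceil> \<le> 2 ^ j" by (simp add: ceiling_le_iff)
      then have "s (card V) \<epsilon> j \<le> 2 ^ j" by (simp add: s_def nat_le_iff)
      also have "\<dots> \<le> 2 ^ ?J" using j by (rule power_increasing) simp
      finally have "s (card V) \<epsilon> j \<le> 2 ^ ?J" .
      moreover have "card V \<le> 2 ^ ?J"
      proof -
        have "2 * real (card V) \<le> 2 ^ ?J" using depth_ge n_pos by (simp add: n_def)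
        then have "real (2 * card V) \<le> real (2 ^ ?J)" by simp
        then have "2 * card V \<le> 2 ^ ?J" by (simp only: of_nat_le_iff)
        then show ?thesis by simp
      qed
      ultimately have "s (card V) \<epsilon> j * card V \<le> 2 ^ ?J * 2 ^ ?J" by (rule mult_le_mono)
      also have "\<dots> < 2 ^ m (card V)"
        by (simp add: m_def power_add[symmetric] mult_2)
      finally show ?thesis
        using evaluates_additive_form[of additive_queries "s (card V) \<epsilon> j" "card V" "m (card V)"]
        by (simp add: s_def)
    qed
    show "s n \<epsilon> j > 0" for n \<epsilon> j by (rule s(3))
    fix n :: nat and \<epsilon> :: real and j :: nat
    assume \<epsilon>: "0 < \<epsilon>" "\<epsilon> < 1"
    note T' = T'[OF \<epsilon>, of n j]
    have "?r j * ?K n \<le> real (s n \<epsilon> j) * (T n \<epsilon> j * \<epsilon>\<^sup>2)"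
      by (rule mult_mono[OF s(1) T']) auto
    moreover have "2 ^ j * ?K n = (?r j)\<^sup>2 * ((?r j)\<^sup>2 * ?K n)"
      using powr_inverse_power[of 4 j] by (simp add: power2_eq_square power4_eq_xxxx mult.assoc)
    moreover have "(?r j)\<^sup>2 * ((?r j)\<^sup>2 * ?K n) \<le> (?r j)\<^sup>2 * ((real (s n \<epsilon> j))\<^sup>2 * (T n \<epsilon> j * \<epsilon>\<^sup>2))"
    proof -
      have "(?r j)\<^sup>2 \<le> (real (s n \<epsilon> j))\<^sup>2"
        using s(1)[of j n \<epsilon>] by (rule power_mono) simp
      then show ?thesis by (rule mult_left_mono[OF mult_mono[OF _ T']]) auto
    qed
    ultimately show "T n \<epsilon> j > 0 \<and> ?K n \<le> T n \<epsilon> j * \<epsilon>\<^sup>2 \<and> ?r j * ?K n \<le> s n \<epsilon> j * T n \<epsilon> j * \<epsilon>\<^sup>2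
        \<and> 2 ^ j * ?K n \<le> (?r j)\<^sup>2 * (real (s n \<epsilon> j))\<^sup>2 * T n \<epsilon> j * \<epsilon>\<^sup>2"
      using T(3)[OF \<epsilon>] T' by (simp add: mult.assoc)
    show "real (T n \<epsilon> j * (3 + 8 * s n \<epsilon> j + m n * m n * (4 * nat \<lceil>?r j\<rceil>)))
      \<le> 57600000 * (1 / \<epsilon>\<^sup>2) * (real (depth n) + 2) ^ 3 * ?r j"
    proof -
      let ?L = "real (depth n) + 2"
      have m: "1 \<le> m n" "real (m n) \<le> 2 * ?L" by (auto simp: m_def)
      \<comment> \<open>15 is 3 + 8 + 4, as both 1 and \<open>s n \<epsilon> j\<close> are at most
        \<open>m n * m n * s n \<epsilon> j\<close>.\<close>
      have "3 + 8 * s n \<epsilon> j + m n * m n * (4 * s n \<epsilon> j) \<le> 15 * (m n * m n * s n \<epsilon> j)"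
      proof -
        have "1 * 1 * s n \<epsilon> j \<le> m n * m n * s n \<epsilon> j" using m(1) by (intro mult_le_mono) auto
        moreover have "m n * m n * (4 * s n \<epsilon> j) = 4 * (m n * m n * s n \<epsilon> j)" by simp
        ultimately show ?thesis using s(3)[of n \<epsilon> j] by linarith
      qed
      then have "real (3 + 8 * s n \<epsilon> j + m n * m n * (4 * s n \<epsilon> j)) \<le> real (15 * (m n * m n * s n \<epsilon> j))"
        by (rule of_nat_mono)
      also have "\<dots> = 15 * (real (m n) * real (m n) * real (s n \<epsilon> j))" by simp
      also have "\<dots> \<le> 15 * ((2 * ?L) * (2 * ?L) * (2 * ?r j))"
        using m s(2)[of n \<epsilon> j] by (intro mult_left_mono mult_mono) auto
      finally have "real (T n \<epsilon> j * (3 + 8 * s n \<epsilon> j + m n * m n * (4 * s n \<epsilon> j)))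
          \<le> (2 * (?K n / \<epsilon>\<^sup>2)) * (15 * ((2 * ?L) * (2 * ?L) * (2 * ?r j)))"
        unfolding of_nat_mult using T(2)[OF \<epsilon>, of n j] by (intro mult_mono) auto
      also have "\<dots> \<le> (2 * (240000 * ?L / \<epsilon>\<^sup>2)) * (15 * ((2 * ?L) * (2 * ?L) * (2 * ?r j)))"
        by (intro mult_right_mono mult_left_mono divide_right_mono) auto
      \<comment> \<open>The constant is 2 * 240000 * 15 * 8.\<close>
      also have "\<dots> = 57600000 * (1 / \<epsilon>\<^sup>2) * ?L ^ 3 * ?r j"
      proof -
        have "2 * (240000 * L / e) * (15 * ((2 * L) * (2 * L) * (2 * r))) = 57600000 * (1 / e) * L ^ 3 * r"
          for L e r :: real
          by (simp add: power3_eq_cube)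
        then show ?thesis .
      qed
      finally show ?thesis by (simp add: s_def)
    qed
  qed auto
  then show ?thesis by (intro exI[of _ "3 / 4"] exI conjI) auto
qed

theorem theorem3p12:
  shows "(\<exists>(A :: nat \<Rightarrow> real \<Rightarrow> 'v algorithm) p C. p > 1 / 2 \<and>
            approximates_average_degree pair_queries A p
              (\<lambda>n d \<epsilon>. C * (1 / \<epsilon> ^ 2) * ln n ^ 5 * (n / d) powr (1 / 3)))
       \<and> (\<exists>(A :: nat \<Rightarrow> real \<Rightarrow> 'v algorithm) p C. p > 1 / 2 \<and>
            approximates_average_degree additive_queries A p
              (\<lambda>n d \<epsilon>. C * (1 / \<epsilon> ^ 2) * ln n ^ 5 * (n / d) powr (1 / 4)))"
  by (intro conjI approximates_pair approximates_additive)


end
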